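(* Let $\Gamma$ be a discrete group with identity $\varepsilon$ and let $\mathcal{G}$ be a strongly $\Gamma$-graded ample groupoid such that $\mathcal{G}^{(0)}$ is $\sigma$-compact. Then $H_n^{\mathrm{gr}}(\mathcal{G})\cong H_n(\mathcal{G}_{\varepsilon})$ for each $n\geq 0$.
   Context: Groupoids: source $s(g)=g^{-1}g$, range $r(g)=gg^{-1}$, unit space $\mathcal{G}^{(0)}$; $(g,h)$ is composable iff $s(g)=r(h)$. An étale groupoid is a locally compact Hausdorff topological groupoid whose source map is a local homeomorphism; it is ample if its topology has a basis of compact open bisections (open sets $U$ on which $s$ and $r$ restrict to homeomorphisms onto open subsets of $\mathcal{G}^{(0)}$). A $\Gamma$-grading on a topological groupoid $\mathcal{G}$ is a continuous map $c:\mathcal{G}\to\Gamma$ ($\Gamma$ discrete) with $c(gh)=c(g)c(h)$ for composable $g,h$; put $\mathcal{G}_\gamma=c^{-1}(\gamma)$. Then $\mathcal{G}_\varepsilon$ is itself a groupoid with unit space $\mathcal{G}^{(0)}$. $\mathcal{G}$ is strongly graded if $\mathcal{G}_\alpha\mathcal{G}_\beta=\mathcal{G}_{\alpha\beta}$ for all $\alpha,\beta\in\Gamma$, where $UV$ is the set of products of composable pairs from $U\times V$. A space is $\sigma$-compact if it has a countable cover by compact sets. Homology: for a locally compact Hausdorff space $X$, $C_c(X,\mathbb{Z})$ is the abelian group of continuous compactly supported functions $X\to\mathbb{Z}$ ($\mathbb{Z}$ discrete). For a local homeomorphism $\pi:X\to Y$, $\pi_*:C_c(X,\mathbb{Z})\to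 C_c(Y,\mathbb{Z})$ is $\pi_*(f)(y)=\sum_{\pi(x)=y}f(x)$. For an étale groupoid $\mathcal{G}$ and $n\ge 1$ let $\mathcal{G}^{(n)}$ be the space of composable strings $(g_1,\dots,g_n)$. For $n\ge2$ let $d_i:\mathcal{G}^{(n)}\to\mathcal{G}^{(n-1)}$, $0\le i\le n$, drop $g_1$ if $i=0$, drop $g_n$ if $i=n$, and replace $g_i,g_{i+1}$ by $g_ig_{i+1}$ otherwise. Put $\partial_0=0$, $\partial_1=s_*-r_*$, $\partial_n=\sum_{i=0}^n(-1)^i(d_i)_*$ for $n\geq 2$. Then $H_n(\mathcal{G})=\ker\partial_n/\operatorname{Im}\partial_{n+1}$. Graded homology: the skew-product $\mathcal{G}\times_c\Gamma$ is the space $\mathcal{G}\times\Gamma$ with product topology, with $(x,\alpha),(y,\beta)$ composable iff $x,y$ are composable and $\alpha=c(y)\beta$, product $(x,c(y)\beta)(y,\beta)=(xy,\beta)$ and inverse $(x,\alpha)^{-1}=(x^{-1},c(x)\alpha)$. Define $H_n^{\mathrm{gr}}(\mathcal{G})=H_n(\mathcal{G}\times_c\Gamma)$. *)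

theory Defs
  imports "HOL-Analysis.Analysis" "HOL-Algebra.Coset"
begin

section \<open>Topological groupoids\<close>

text \<open>The multiplication is a total function whose values are only meaningful on composable pairs;
  composability is not part of the data but defined by \<open>s(g) = r(h)\<close>.\<close>

record 'a top_groupoid =
  gtop :: "'a topology"
  gmult :: "'a \<Rightarrow> 'a \<Rightarrow> 'a"
  ginv :: "'a \<Rightarrow> 'a"

definition garr :: "('a, 'm) top_groupoid_scheme \<Rightarrow> 'a set"
  where "garr G = topspace (gtop G)"

definition gsrc :: "('a, 'm) top_groupoid_scheme \<Rightarrow> 'a \<Rightarrow> 'a"
  where "gsrc G g = gmult G (ginv G g) g"

definition grng :: "('a, 'm) top_groupoid_scheme \<Rightarrow> 'a \<Rightarrow> 'a"
  where "grng G g = gmult G g (ginv G g)"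

definition composable :: "('a, 'm) top_groupoid_scheme \<Rightarrow> 'a \<Rightarrow> 'a \<Rightarrow> bool"
  where "composable G g h \<longleftrightarrow> g \<in> garr G \<and> h \<in> garr G \<and> gsrc G g = grng G h"

definition gunits :: "('a, 'm) top_groupoid_scheme \<Rightarrow> 'a set"
  where "gunits G = gsrc G ` garr G"

definition unit_space :: "('a, 'm) top_groupoid_scheme \<Rightarrow> 'a topology"
  where "unit_space G = subtopology (gtop G) (gunits G)"

locale groupoid =
  fixes G :: "('a, 'm) top_groupoid_scheme"
  assumes mult_closed: "composable G g h \<Longrightarrow> gmult G g h \<in> garr G"
    and inv_closed: "g \<in> garr G \<Longrightarrow> ginv G g \<in> garr G"
    and inv_inv: "g \<in> garr G \<Longrightarrow> ginv G (ginv G g) = g"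
    and src_mult: "composable G g h \<Longrightarrow> gsrc G (gmult G g h) = gsrc G h"
    and rng_mult: "composable G g h \<Longrightarrow> grng G (gmult G g h) = grng G g"
    and mult_assoc: "composable G g h \<Longrightarrow> composable G h k \<Longrightarrow>
          gmult G (gmult G g h) k = gmult G g (gmult G h k)"
    and inv_mult_cancel: "composable G g h \<Longrightarrow> gmult G (ginv G g) (gmult G g h) = h"
    and mult_inv_cancel: "composable G g h \<Longrightarrow> gmult G (gmult G g h) (ginv G h) = g"

locale topological_groupoid = groupoid +
  assumes continuous_mult:
      "continuous_map (subtopology (prod_topology (gtop G) (gtop G)) {(g, h). composable G g h})
         (gtop G) (\<lambda>(g, h). gmult G g h)"
    and continuous_inv: "continuous_map (gtop G) (gtop G) (ginv G)"

definition local_homeomorphism :: "'a topology \<Rightarrow> 'b topology \<Rightarrow> ('a \<Rightarrow> 'b) \<Rightarrow> bool"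
  where "local_homeomorphism X Y f \<longleftrightarrow>
    (\<forall>x\<in>topspace X. \<exists>U. openin X U \<and> x \<in> U \<and> openin Y (f ` U) \<and>
       homeomorphic_map (subtopology X U) (subtopology Y (f ` U)) f)"

locale etale_groupoid = topological_groupoid +
  assumes locally_compact: "locally_compact_space (gtop G)"
    and Hausdorff: "Hausdorff_space (gtop G)"
    and local_homeomorphism_src: "local_homeomorphism (gtop G) (unit_space G) (gsrc G)"

definition open_bisection :: "('a, 'm) top_groupoid_scheme \<Rightarrow> 'a set \<Rightarrow> bool"
  where "open_bisection G U \<longleftrightarrow> openin (gtop G) U \<and>
    (\<forall>f\<in>{gsrc G, grng G}. openin (unit_space G) (f ` U) \<and>
       homeomorphic_map (subtopology (gtop G) U) (subtopology (unit_space G) (f ` U)) f)"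

locale ample_groupoid = etale_groupoid +
  assumes compact_open_bisection_basis:
    "openin (gtop G) W \<Longrightarrow> g \<in> W \<Longrightarrow>
       \<exists>U. open_bisection G U \<and> compactin (gtop G) U \<and> g \<in> U \<and> U \<subseteq> W"

definition sigma_compact_space :: "'a topology \<Rightarrow> bool"
  where "sigma_compact_space X \<longleftrightarrow>
    (\<exists>\<K>. countable \<K> \<and> (\<forall>K\<in>\<K>. compactin X K) \<and> \<Union>\<K> = topspace X)"


section \<open>Gradings\<close>

locale graded_groupoid = topological_groupoid G + \<Gamma>: group \<Gamma>
  for G :: "('a, 'm) top_groupoid_scheme" and \<Gamma> :: "('g, 'k) monoid_scheme" +
  fixes c :: "'a \<Rightarrow> 'g"
  assumes continuous_grading: "continuous_map (gtop G) (discrete_topology (carrier \<Gamma>)) c"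
    and grading_mult: "composable G g h \<Longrightarrow> c (gmult G g h) = c g \<otimes>\<^bsub>\<Gamma>\<^esub> c h"

definition homogeneous_part :: "('a, 'm) top_groupoid_scheme \<Rightarrow> ('a \<Rightarrow> 'g) \<Rightarrow> 'g \<Rightarrow> 'a set"
  where "homogeneous_part G c \<gamma> = {g \<in> garr G. c g = \<gamma>}"

definition set_product :: "('a, 'm) top_groupoid_scheme \<Rightarrow> 'a set \<Rightarrow> 'a set \<Rightarrow> 'a set"
  where "set_product G U V = {gmult G g h | g h. g \<in> U \<and> h \<in> V \<and> composable G g h}"

locale strongly_graded_groupoid = graded_groupoid +
  assumes strongly_graded: "\<alpha> \<in> carrier \<Gamma> \<Longrightarrow> \<beta> \<in> carrier \<Gamma> \<Longrightarrow>
    set_product G (homogeneous_part G c \<alpha>) (homogeneous_part G c \<beta>)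
      = homogeneous_part G c (\<alpha> \<otimes>\<^bsub>\<Gamma>\<^esub> \<beta>)"

definition identity_subgroupoid ::
    "('g, 'k) monoid_scheme \<Rightarrow> 'a top_groupoid \<Rightarrow> ('a \<Rightarrow> 'g) \<Rightarrow> 'a top_groupoid"
  where "identity_subgroupoid \<Gamma> G c =
    \<lparr>gtop = subtopology (gtop G) (homogeneous_part G c \<one>\<^bsub>\<Gamma>\<^esub>),
     gmult = gmult G, ginv = ginv G\<rparr>"

text \<open>The composability condition \<open>\<alpha> = c(y)\<beta>\<close> of the skew product is not built into its
  multiplication; it is the condition \<open>s(x,\<alpha>) = r(y,\<beta>)\<close>, see \<open>composable_skew_product\<close> below.\<close>

definition skew_product ::
    "('g, 'k) monoid_scheme \<Rightarrow> 'a top_groupoid \<Rightarrow> ('a \<Rightarrow> 'g) \<Rightarrow> ('a \<times> 'g) top_groupoid"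
  where "skew_product \<Gamma> G c =
    \<lparr>gtop = prod_topology (gtop G) (discrete_topology (carrier \<Gamma>)),
     gmult = (\<lambda>(x, \<alpha>) (y, \<beta>). (gmult G x y, \<beta>)),
     ginv = (\<lambda>(x, \<alpha>). (ginv G x, c x \<otimes>\<^bsub>\<Gamma>\<^esub> \<alpha>))\<rparr>"

lemma garr_skew_product: "garr (skew_product \<Gamma> G c) = garr G \<times> carrier \<Gamma>"
  by (simp add: garr_def skew_product_def)

lemma gsrc_skew_product: "gsrc (skew_product \<Gamma> G c) (x, \<alpha>) = (gsrc G x, \<alpha>)"
  by (simp add: gsrc_def skew_product_def)

lemma grng_skew_product: "grng (skew_product \<Gamma> G c) (x, \<alpha>) = (grng G x, c x \<otimes>\<^bsub>\<Gamma>\<^esub> \<alpha>)"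
  by (simp add: grng_def skew_product_def)

lemma composable_skew_product:
  "composable (skew_product \<Gamma> G c) (x, \<alpha>) (y, \<beta>) \<longleftrightarrow>
     composable G x y \<and> \<alpha> \<in> carrier \<Gamma> \<and> \<beta> \<in> carrier \<Gamma> \<and> \<alpha> = c y \<otimes>\<^bsub>\<Gamma>\<^esub> \<beta>"
  by (auto simp: composable_def garr_skew_product gsrc_skew_product grng_skew_product)


section \<open>Homology\<close>

text \<open>Functions on a space are represented by total functions vanishing outside it.\<close>

definition Cc_group :: "'x topology \<Rightarrow> ('x \<Rightarrow> int) monoid"
  where "Cc_group X =
    \<lparr>carrier = {f. continuous_map X (discrete_topology UNIV) f \<and>
                 compactin X (X closure_of {x \<in> topspace X. f x \<noteq> 0}) \<and>
                 (\<forall>x. x \<notin> topspace X \<longrightarrow> f x = 0)},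
     mult = (\<lambda>f g x. f x + g x),
     one = (\<lambda>x. 0)\<rparr>"

text \<open>The sum ranges over the part of the fibre where \<open>f\<close> does not vanish, which is finite
  when \<open>\<pi>\<close> is a local homeomorphism and \<open>f \<in> C\<^sub>c(X, \<int>)\<close>; the fibre itself may be infinite.\<close>

definition pushforward :: "'x topology \<Rightarrow> ('x \<Rightarrow> 'y) \<Rightarrow> ('x \<Rightarrow> int) \<Rightarrow> 'y \<Rightarrow> int"
  where "pushforward X \<pi> f y = (\<Sum>x | x \<in> topspace X \<and> \<pi> x = y \<and> f x \<noteq> 0. f x)"

text \<open>A string \<open>(g\<^sub>1, \<dots>, g\<^sub>n)\<close> is a function on \<open>{1..n}\<close>, extensional outside of it. So that all the
  spaces \<open>G\<^sup>(\<^sup>n\<^sup>)\<close> live in one type, a unit \<open>u\<close> is identified with the one-entry string \<open>(u)\<close> for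
  \<open>n = 0\<close>.\<close>

definition nerve :: "'a top_groupoid \<Rightarrow> nat \<Rightarrow> (nat \<Rightarrow> 'a) topology"
  where "nerve G n =
    (if n = 0 then product_topology (\<lambda>_. unit_space G) {1}
     else subtopology (product_topology (\<lambda>_. gtop G) {1..n})
            {g. \<forall>i. 1 \<le> i \<and> i < n \<longrightarrow> composable G (g i) (g (Suc i))})"

text \<open>The case distinction covers the extreme indices: for \<open>i = 0\<close> only the last branch occurs
  (dropping \<open>g\<^sub>1\<close>), for \<open>i = n\<close> only the first (dropping \<open>g\<^sub>n\<close>).\<close>

definition face :: "'a top_groupoid \<Rightarrow> nat \<Rightarrow> nat \<Rightarrow> (nat \<Rightarrow> 'a) \<Rightarrow> nat \<Rightarrow> 'a"
  where "face G n i g =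
    (\<lambda>j\<in>{1..n - 1}. if j < i then g j
                    else if j = i then gmult G (g i) (g (Suc i))
                    else g (Suc j))"

definition boundary ::
    "'a top_groupoid \<Rightarrow> nat \<Rightarrow> ((nat \<Rightarrow> 'a) \<Rightarrow> int) \<Rightarrow> (nat \<Rightarrow> 'a) \<Rightarrow> int"
  where "boundary G n f =
    (if n = 0 then (\<lambda>x. 0)
     else if n = 1 then
       (\<lambda>x. pushforward (nerve G 1) (\<lambda>g. \<lambda>j\<in>{1}. gsrc G (g j)) f x
          - pushforward (nerve G 1) (\<lambda>g. \<lambda>j\<in>{1}. grng G (g j)) f x)
     else (\<lambda>x. \<Sum>i=0..n. (- 1) ^ i * pushforward (nerve G n) (face G n i) f x))"

definition cycles :: "'a top_groupoid \<Rightarrow> nat \<Rightarrow> ((nat \<Rightarrow> 'a) \<Rightarrow> int) set"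
  where "cycles G n = {f \<in> carrier (Cc_group (nerve G n)). boundary G n f = (\<lambda>x. 0)}"

definition boundaries :: "'a top_groupoid \<Rightarrow> nat \<Rightarrow> ((nat \<Rightarrow> 'a) \<Rightarrow> int) set"
  where "boundaries G n = boundary G (Suc n) ` carrier (Cc_group (nerve G (Suc n)))"

definition groupoid_homology :: "'a top_groupoid \<Rightarrow> nat \<Rightarrow> ((nat \<Rightarrow> 'a) \<Rightarrow> int) set monoid"
  where "groupoid_homology G n =
    (Cc_group (nerve G n))\<lparr>carrier := cycles G n\<rparr> Mod boundaries G n"

definition graded_homology ::
    "('g, 'k) monoid_scheme \<Rightarrow> 'a top_groupoid \<Rightarrow> ('a \<Rightarrow> 'g) \<Rightarrow> nat \<Rightarrow>
       ((nat \<Rightarrow> 'a \<times> 'g) \<Rightarrow> int) set monoid"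
  where "graded_homology \<Gamma> G c n = groupoid_homology (skew_product \<Gamma> G c) n"

end

theory Submission
  imports Defs
begin

text \<open>Write \<open>L\<close> for the identity component \<open>G\<^sub>\<epsilon>\<close> and \<open>K\<close> for the skew product. An arrow \<open>(x, \<alpha>)\<close> of
  \<open>K\<close> runs from the object \<open>(s(x), \<alpha>)\<close> to the object \<open>(r(x), c(x)\<alpha>)\<close>, so the arrows between objects
  of colour \<open>\<epsilon>\<close> are the \<open>(x, \<epsilon>)\<close> with \<open>c(x) = \<epsilon>\<close>: the map \<open>x \<mapsto> (x, \<epsilon>)\<close> (\<open>incl\<close>) identifies \<open>L\<close> with the
  restriction of \<open>K\<close> to the clopen set of objects of colour \<open>\<epsilon>\<close>. Strong grading says that every object
  \<open>(u, \<alpha>)\<close> is joined to one of colour \<open>\<epsilon>\<close>: there is \<open>g\<close> of degree \<open>\<alpha>\<inverse>\<close> with source \<open>u\<close>, and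
  \<open>(g, \<alpha>)\<close> ends at \<open>(r(g), \<epsilon>)\<close>. So \<open>incl\<close> is an equivalence of abstract groupoids, and the theorem
  holds because this equivalence can be chosen continuously.

  The continuous choice is where ampleness and \<open>\<sigma>\<close>-compactness enter: countably many compact open
  bisections of degree \<open>\<alpha>\<inverse>\<close> have sources covering the unit space; these sources are clopen, so they
  can be made disjoint, and the inverses of the source map glue to a continuous section of degree
  \<open>\<alpha>\<inverse>\<close> (\<open>etale_map_global_section\<close>, \<open>strongly_graded_continuous_section\<close>). Together the
  sections form a map \<open>b\<close> with \<open>b(u, \<alpha>)\<close> an arrow of degree \<open>\<alpha>\<inverse>\<close> and source \<open>u\<close>, normalised by
  \<open>b(u, \<epsilon>) = u\<close>. Conjugation by \<open>b\<close>,
  \<open>(x, \<alpha>) \<mapsto> b(r(x), c(x)\<alpha>) x b(s(x), \<alpha>)\<inverse>\<close>,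
  is a continuous homomorphism \<open>retract\<close> from \<open>K\<close> to \<open>L\<close> that is a left inverse of \<open>incl\<close>, and
  \<open>(u, \<alpha>) \<mapsto> (b(u, \<alpha>), \<alpha>)\<close> is a continuous natural transformation from the identity of \<open>K\<close> to
  \<open>incl \<circ> retract\<close>.

  A homomorphism that is etale on units is etale on all nerves and induces a chain map by
  pushforward. A continuous natural transformation from the identity yields prism operators on the
  nerves, which satisfy the identities of a simplicial homotopy and are etale as well, so their
  alternating sum is a chain homotopy (\<open>homotopy_formula\<close>). Hence \<open>retract\<close> and \<open>incl\<close> are mutually
  inverse on homology.

  That all maps of nerves that occur are etale has one common reason. The projection of a nerve to
  its last vertex is etale, being an iterated pullback of the source map
  (\<open>etale_map_last_vertex\<close>), and a continuous map \<open>p\<close> is etale as soon as \<open>q\<close> and \<open>q \<circ> p\<close> are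
  (\<open>etale_map_cancel\<close>). So it is enough to look at what a map does to the last vertex.\<close>

section \<open>Etale maps\<close>

text \<open>Equivalently, a local homeomorphism. The form is chosen because openness and local injectivity
  can be composed and cancelled separately.\<close>

definition etale_map :: "'a topology \<Rightarrow> 'b topology \<Rightarrow> ('a \<Rightarrow> 'b) \<Rightarrow> bool"
  where "etale_map X Y f \<longleftrightarrow> continuous_map X Y f \<and> open_map X Y f \<and>
    (\<forall>x\<in>topspace X. \<exists>U. openin X U \<and> x \<in> U \<and> inj_on f U)"

lemma etale_mapD:
  assumes "etale_map X Y f"
  shows "continuous_map X Y f" "open_map X Y f"
    "x \<in> topspace X \<Longrightarrow> \<exists>U. openin X U \<and> x \<in> U \<and> inj_on f U"
  using assms by (auto simp: etale_map_def)

lemma etale_map_id: "etale_map X X (\<lambda>x. x)"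
  unfolding etale_map_def using open_map_id[of X] by (auto simp: id_def inj_on_def intro: exI[of _ "topspace X"])

lemma etale_map_compose:
  assumes f: "etale_map X Y f" and g: "etale_map Y Z g"
  shows "etale_map X Z (\<lambda>x. g (f x))"
  unfolding etale_map_def
proof (intro conjI ballI)
  show "continuous_map X Z (\<lambda>x. g (f x))"
    using continuous_map_compose[of X Y f Z g] f g by (auto simp: etale_map_def o_def)
  show "open_map X Z (\<lambda>x. g (f x))"
    using open_map_compose[of X Y f Z g] f g by (auto simp: etale_map_def o_def)
  fix x assume x: "x \<in> topspace X"
  obtain U where U: "openin X U" "x \<in> U" "inj_on f U"
    using etale_mapD(3)[OF f x] by blast
  have "f x \<in> topspace Y" using etale_mapD(1)[OF f] x by (auto simp: continuous_map_def)
  then obtain V where V: "openin Y V" "f x \<in> V" "inj_on g V"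
    using etale_mapD(3)[OF g] by blast
  have "openin X (U \<inter> {x \<in> topspace X. f x \<in> V})"
    using U V etale_mapD(1)[OF f] by (intro openin_Int openin_continuous_map_preimage) auto
  moreover have "inj_on (\<lambda>x. g (f x)) (U \<inter> {x \<in> topspace X. f x \<in> V})"
    using U V by (auto simp: inj_on_def)
  ultimately show "\<exists>U. openin X U \<and> x \<in> U \<and> inj_on (\<lambda>x. g (f x)) U"
    using U V x by blast
qed

lemma etale_map_cong:
  assumes "etale_map X Y f" and "\<And>x. x \<in> topspace X \<Longrightarrow> f x = g x"
  shows "etale_map X Y g"
  unfolding etale_map_def
proof (intro conjI ballI)
  show "continuous_map X Y g" using continuous_map_eq etale_mapD(1)[OF assms(1)] assms(2) by metis
  show "open_map X Y g" using open_map_eq etale_mapD(2)[OF assms(1)] assms(2) by metis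
  fix x assume "x \<in> topspace X"
  then obtain U where U: "openin X U" "x \<in> U" "inj_on f U" using etale_mapD(3)[OF assms(1)] by blast
  then have "inj_on g U" using assms(2) openin_subset[OF U(1)] by (auto simp: inj_on_def subset_iff)
  then show "\<exists>U. openin X U \<and> x \<in> U \<and> inj_on g U" using U by blast
qed

text \<open>Local injectivity of \<open>q \<circ> p\<close> passes to \<open>p\<close>. For openness, near a point \<open>p(x)\<close> the map \<open>q\<close> is
  injective, so there the image under \<open>p\<close> of a small neighbourhood of \<open>x\<close> is the preimage under \<open>q\<close> of
  its image under \<open>q \<circ> p\<close>, which is open.\<close>

lemma etale_map_cancel:
  assumes qp: "etale_map X Z (\<lambda>x. q (p x))" and q: "etale_map Y Z q" and p: "continuous_map X Y p"
  shows "etale_map X Y p"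
  unfolding etale_map_def
proof (intro conjI ballI)
  show "continuous_map X Y p" by (rule p)
  show "open_map X Y p"
    unfolding open_map_def
  proof (intro allI impI)
    fix U assume U: "openin X U"
    show "openin Y (p ` U)"
    proof (subst openin_subopen, intro ballI)
      fix y assume "y \<in> p ` U"
      then obtain x where x: "x \<in> U" "y = p x" by blast
      have "y \<in> topspace Y" using x p openin_subset[OF U] by (auto simp: continuous_map_def)
      then obtain V where V: "openin Y V" "y \<in> V" "inj_on q V"
        using etale_mapD(3)[OF q] by blast
      let ?U = "U \<inter> {x \<in> topspace X. p x \<in> V}"
      let ?W = "V \<inter> {y \<in> topspace Y. q y \<in> (\<lambda>x. q (p x)) ` ?U}"
      have "openin X ?U"
        using U V p by (intro openin_Int openin_continuous_map_preimage) auto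
      then have "openin Z ((\<lambda>x. q (p x)) ` ?U)"
        using etale_mapD(2)[OF qp] by (auto simp: open_map_def)
      then have "openin Y ?W"
        using V etale_mapD(1)[OF q] by (intro openin_Int openin_continuous_map_preimage) auto
      moreover have "y \<in> ?W"
        using x V openin_subset[OF U] \<open>y \<in> topspace Y\<close> by auto
      moreover have "?W \<subseteq> p ` U"
        using V(3) by (auto simp: inj_on_def)
      ultimately show "\<exists>T. openin Y T \<and> y \<in> T \<and> T \<subseteq> p ` U" by blast
    qed
  qed
  fix x assume "x \<in> topspace X"
  then obtain U where U: "openin X U" "x \<in> U" "inj_on (\<lambda>x. q (p x)) U"
    using etale_mapD(3)[OF qp] by blast
  then have "inj_on p U" by (auto simp: inj_on_def)
  then show "\<exists>U. openin X U \<and> x \<in> U \<and> inj_on p U" using U by blast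
qed

lemma local_homeomorphism_imp_etale_map:
  assumes f: "local_homeomorphism X Y f" and m: "f ` topspace X \<subseteq> topspace Y"
  shows "etale_map X Y f"
proof -
  have ex: "\<exists>U. openin X U \<and> x \<in> U \<and> openin Y (f ` U) \<and>
       homeomorphic_map (subtopology X U) (subtopology Y (f ` U)) f" if "x \<in> topspace X" for x
    using f that by (auto simp: local_homeomorphism_def)
  have op: "openin X {x \<in> topspace X. f x \<in> V}" if V: "openin Y V" for V
  proof (subst openin_subopen, intro ballI)
    fix x assume "x \<in> {x \<in> topspace X. f x \<in> V}"
    then obtain U where U: "openin X U" "x \<in> U" "openin Y (f ` U)" "f x \<in> V"
      and h: "homeomorphic_map (subtopology X U) (subtopology Y (f ` U)) f" using ex by blast
    have "continuous_map (subtopology X U) Y f"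
      using homeomorphic_imp_continuous_map[OF h] by (simp add: continuous_map_in_subtopology)
    then have "openin (subtopology X U) {x \<in> topspace (subtopology X U). f x \<in> V}"
      using V openin_continuous_map_preimage by blast
    then have "openin X {x \<in> topspace (subtopology X U). f x \<in> V}"
      using U(1) openin_trans_full by blast
    then show "\<exists>T. openin X T \<and> x \<in> T \<and> T \<subseteq> {x \<in> topspace X. f x \<in> V}"
      using U openin_subset[OF U(1)] by (intro exI[of _ "{x \<in> topspace (subtopology X U). f x \<in> V}"]) auto
  qed
  show ?thesis
    unfolding etale_map_def
  proof (intro conjI ballI)
    show "continuous_map X Y f" using op m by (auto simp: continuous_map_def)
    show "open_map X Y f"
      unfolding open_map_def
    proof (intro allI impI)
      fix W assume W: "openin X W"
      show "openin Y (f ` W)"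
      proof (subst openin_subopen, intro ballI)
        fix y assume "y \<in> f ` W"
        then obtain x where x: "x \<in> W" "y = f x" by blast
        then obtain U where U: "openin X U" "x \<in> U" "openin Y (f ` U)"
          and h: "homeomorphic_map (subtopology X U) (subtopology Y (f ` U)) f"
          using ex openin_subset[OF W] by blast
        have "openin (subtopology X U) (U \<inter> W)" using W by (simp add: openin_subtopology_Int2)
        then have "openin (subtopology Y (f ` U)) (f ` (U \<inter> W))"
          using homeomorphic_imp_open_map[OF h] by (simp add: open_map_def)
        then have "openin Y (f ` (U \<inter> W))" using U(3) openin_trans_full by blast
        then show "\<exists>T. openin Y T \<and> y \<in> T \<and> T \<subseteq> f ` W" using U x by blast
      qed
    qed
    fix x assume "x \<in> topspace X"
    then obtain U where U: "openin X U" "x \<in> U" "openin Y (f ` U)"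
          and h: "homeomorphic_map (subtopology X U) (subtopology Y (f ` U)) f"
      using ex by blast
    then have "inj_on f U"
      using homeomorphic_imp_injective_map[OF h] openin_subset[OF U(1)] by (simp add: Int_absorb1)
    then show "\<exists>U. openin X U \<and> x \<in> U \<and> inj_on f U" using U by blast
  qed
qed

lemma etale_map_involution:
  assumes c: "continuous_map X X f" and i: "\<And>x. x \<in> topspace X \<Longrightarrow> f (f x) = x"
  shows "etale_map X X f"
  unfolding etale_map_def
proof (intro conjI ballI)
  show "continuous_map X X f" by (rule c)
  have m: "f x \<in> topspace X" if "x \<in> topspace X" for x using c that by (auto simp: continuous_map_def)
  show "open_map X X f"
    unfolding open_map_def
  proof (intro allI impI)
    fix U assume U: "openin X U"
    have "f ` U = {x \<in> topspace X. f x \<in> U}"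
    proof (intro equalityI subsetI)
      fix x assume "x \<in> {x \<in> topspace X. f x \<in> U}"
      then show "x \<in> f ` U" using i by (auto intro: image_eqI[of x f "f x"])
    qed (use openin_subset[OF U] i m in auto)
    then show "openin X (f ` U)" using openin_continuous_map_preimage[OF c U] by simp
  qed
  fix x assume "x \<in> topspace X"
  moreover have "inj_on f (topspace X)" using i by (metis inj_onI)
  ultimately show "\<exists>U. openin X U \<and> x \<in> U \<and> inj_on f U" by blast
qed

text \<open>A map with a continuous local section through each of its points is open: the preimage of an
  open set under a section lies in the image of that set.\<close>

lemma etale_mapI_local_sections:
  assumes f: "continuous_map X Y f"
    and ex: "\<And>x. x \<in> topspace X \<Longrightarrow> \<exists>U V e. openin X U \<and> x \<in> U \<and> inj_on f U \<and> openin Y V \<and> f x \<in> V \<and>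
      continuous_map (subtopology Y V) X e \<and> e (f x) = x \<and> (\<forall>y\<in>V. f (e y) = y)"
  shows "etale_map X Y f"
  unfolding etale_map_def
proof (intro conjI ballI)
  show "open_map X Y f"
    unfolding open_map_def
  proof (intro allI impI)
    fix W assume W: "openin X W"
    show "openin Y (f ` W)"
    proof (subst openin_subopen, intro ballI)
      fix y assume "y \<in> f ` W"
      then obtain x where x: "x \<in> W" "y = f x" by blast
      have xX: "x \<in> topspace X" using x(1) openin_subset[OF W] by blast
      from ex[OF xX] obtain V e where V: "openin Y V" "f x \<in> V"
        "continuous_map (subtopology Y V) X e" "e (f x) = x" "\<forall>y\<in>V. f (e y) = y" by blast
      let ?T = "{y \<in> topspace (subtopology Y V). e y \<in> W}"
      have "openin (subtopology Y V) ?T"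
        by (rule openin_continuous_map_preimage[OF V(3) W])
      then have "openin Y ?T" using V(1) openin_trans_full by blast
      moreover have "y \<in> ?T" using x xX V f by (auto simp: continuous_map_def)
      moreover have "?T \<subseteq> f ` W"
      proof
        fix z assume "z \<in> ?T"
        then have "z = f (e z)" "e z \<in> W" using V(5) by auto
        then show "z \<in> f ` W" by (rule image_eqI)
      qed
      ultimately show "\<exists>T. openin Y T \<and> y \<in> T \<and> T \<subseteq> f ` W" by blast
    qed
  qed
  show "\<exists>U. openin X U \<and> x \<in> U \<and> inj_on f U" if "x \<in> topspace X" for x
    using ex[OF that] by blast
qed (rule f)

lemma etale_map_local_inverse:
  assumes f: "etale_map X Y f" and U: "openin X U" "inj_on f U"
  shows "continuous_map (subtopology Y (f ` U)) X (inv_into U f)"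
  unfolding continuous_map_def
proof (intro conjI allI impI)
  have UX: "U \<subseteq> topspace X" by (rule openin_subset[OF U(1)])
  show "inv_into U f \<in> topspace (subtopology Y (f ` U)) \<rightarrow> topspace X"
    using UX inv_into_into[of _ f U] by fastforce
  fix W assume W: "openin X W"
  have fU: "f ` U \<subseteq> topspace Y" using UX etale_mapD(1)[OF f] by (auto simp: continuous_map_def)
  have "{y \<in> topspace (subtopology Y (f ` U)). inv_into U f y \<in> W} = f ` (U \<inter> W)"
    using fU U(2) by auto
  moreover have "openin Y (f ` (U \<inter> W))"
    using etale_mapD(2)[OF f] U(1) W by (auto simp: open_map_def)
  moreover have "f ` (U \<inter> W) \<subseteq> f ` U" by blast
  ultimately show "openin (subtopology Y (f ` U)) {y \<in> topspace (subtopology Y (f ` U)). inv_into U f y \<in> W}"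
    by (metis (no_types, lifting) inf.absorb_iff2 openin_subtopology_Int2)
qed

lemma etale_map_restrict_open:
  assumes f: "etale_map X Y f" and U: "openin X U"
  shows "etale_map (subtopology X U) Y f"
  unfolding etale_map_def
proof (intro conjI ballI)
  show "continuous_map (subtopology X U) Y f"
    using etale_mapD(1)[OF f] by (rule continuous_map_from_subtopology)
  show "open_map (subtopology X U) Y f"
    using etale_mapD(2)[OF f] U by (rule open_map_from_subtopology)
  fix x assume x: "x \<in> topspace (subtopology X U)"
  then obtain V where V: "openin X V" "x \<in> V" "inj_on f V" using etale_mapD(3)[OF f, of x] by auto
  have "openin (subtopology X U) (U \<inter> V)" using V(1) by (rule openin_subtopology_Int2)
  moreover have "inj_on f (U \<inter> V)" using V(3) by (rule inj_on_subset) blast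
  ultimately show "\<exists>V. openin (subtopology X U) V \<and> x \<in> V \<and> inj_on f V" using x V(2) by auto
qed

lemma etale_map_times_id:
  assumes f: "etale_map X Y f"
  shows "etale_map (prod_topology X Z) (prod_topology Y Z) (\<lambda>p. (f (fst p), snd p))"
  unfolding etale_map_def
proof (intro conjI ballI)
  show "continuous_map (prod_topology X Z) (prod_topology Y Z) (\<lambda>p. (f (fst p), snd p))"
    using continuous_map_compose[OF continuous_map_fst etale_mapD(1)[OF f]]
    by (intro continuous_map_pairedI continuous_map_snd) (simp add: o_def)
  show "open_map (prod_topology X Z) (prod_topology Y Z) (\<lambda>p. (f (fst p), snd p))"
    unfolding open_map_def
  proof (intro allI impI)
    fix W assume W: "openin (prod_topology X Z) W"
    show "openin (prod_topology Y Z) ((\<lambda>p. (f (fst p), snd p)) ` W)"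
      unfolding openin_prod_topology_alt
    proof (intro allI impI)
      fix y z assume "(y, z) \<in> (\<lambda>p. (f (fst p), snd p)) ` W"
      then obtain x where x: "(x, z) \<in> W" "y = f x" by auto
      then obtain U V where UV: "openin X U" "openin Z V" "x \<in> U" "z \<in> V" "U \<times> V \<subseteq> W"
        using W[unfolded openin_prod_topology_alt, rule_format, OF x(1)] by blast
      have "openin Y (f ` U)" using etale_mapD(2)[OF f] UV(1) by (simp add: open_map_def)
      moreover have "f ` U \<times> V \<subseteq> (\<lambda>p. (f (fst p), snd p)) ` W" using UV(5) by force
      ultimately show "\<exists>U V. openin Y U \<and> openin Z V \<and> y \<in> U \<and> z \<in> V \<and> U \<times> V \<subseteq> (\<lambda>p. (f (fst p), snd p)) ` W"
        using UV x(2) by blast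
    qed
  qed
  fix p assume p: "p \<in> topspace (prod_topology X Z)"
  then obtain U where U: "openin X U" "fst p \<in> U" "inj_on f U" using etale_mapD(3)[OF f, of "fst p"] by auto
  have "openin (prod_topology X Z) (U \<times> topspace Z)" using U(1) by (simp add: openin_prod_Times_iff)
  moreover have "p \<in> U \<times> topspace Z" using p U(2) by auto
  moreover have "inj_on (\<lambda>p. (f (fst p), snd p)) (U \<times> topspace Z)" using U(3) by (auto simp: inj_on_def)
  ultimately show "\<exists>U. openin (prod_topology X Z) U \<and> p \<in> U \<and> inj_on (\<lambda>p. (f (fst p), snd p)) U" by blast
qed

text \<open>The image of an open set is cut out of the open image of \<open>i\<close> by a condition on \<open>p\<close>.\<close>

lemma etale_map_open_embedding:
  assumes i: "continuous_map X Y i" and p: "continuous_map Y X p"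
    and pi: "\<And>x. x \<in> topspace X \<Longrightarrow> p (i x) = x" and op: "openin Y (i ` topspace X)"
  shows "etale_map X Y i"
  unfolding etale_map_def
proof (intro conjI ballI)
  show "open_map X Y i"
    unfolding open_map_def
  proof (intro allI impI)
    fix U assume U: "openin X U"
    have "i ` U = i ` topspace X \<inter> {y \<in> topspace Y. p y \<in> U}"
      using openin_subset[OF U] openin_subset[OF op] pi by auto
    moreover have "openin Y (i ` topspace X \<inter> {y \<in> topspace Y. p y \<in> U})"
      using op openin_continuous_map_preimage[OF p U] by (rule openin_Int)
    ultimately show "openin Y (i ` U)" by simp
  qed
  have "inj_on i (topspace X)" using pi by (metis inj_onI)
  then show "\<exists>U. openin X U \<and> x \<in> U \<and> inj_on i U" if "x \<in> topspace X" for x using that by blast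
qed (rule i)

text \<open>A compact set is covered by finitely many open sets on which \<open>f\<close> is injective, and each of them
  meets the fibre at most once.\<close>

lemma etale_map_finite_fibre:
  assumes f: "etale_map X Y f" and S: "compactin X S"
  shows "finite {x \<in> S. f x = y}"
proof -
  let ?\<U> = "{U. openin X U \<and> inj_on f U}"
  have "S \<subseteq> \<Union>?\<U>"
    using compactin_subset_topspace[OF S] etale_mapD(3)[OF f] by fastforce
  then obtain \<F> where \<F>: "finite \<F>" "\<F> \<subseteq> ?\<U>" "S \<subseteq> \<Union>\<F>"
    using S unfolding compactin_def by (metis (no_types, lifting) mem_Collect_eq)
  have "finite {x \<in> U. f x = y}" if "U \<in> \<F>" for U
  proof -
    have "inj_on f {x \<in> U. f x = y}" using that \<F>(2) by (auto simp: inj_on_def)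
    then show ?thesis by (rule inj_on_finite[where B = "{y}"]) auto
  qed
  then have "finite (\<Union>U\<in>\<F>. {x \<in> U. f x = y})" using \<F>(1) by blast
  then show ?thesis by (rule finite_subset[rotated]) (use \<F>(3) in auto)
qed


section \<open>Compactly supported functions and their pushforward\<close>

abbreviation supp :: "'x topology \<Rightarrow> ('x \<Rightarrow> int) \<Rightarrow> 'x set"
  where "supp X f \<equiv> {x \<in> topspace X. f x \<noteq> 0}"

abbreviation Cc :: "'x topology \<Rightarrow> ('x \<Rightarrow> int) set"
  where "Cc X \<equiv> carrier (Cc_group X)"

text \<open>The nonvanishing set of a continuous integer valued function is closed, so taking its closure
  changes nothing.\<close>

lemma Cc_iff:
  "f \<in> Cc X \<longleftrightarrow> continuous_map X (discrete_topology UNIV) f \<and> compactin X (supp X f) \<and>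
     (\<forall>x. x \<notin> topspace X \<longrightarrow> f x = 0)"
proof -
  have "X closure_of supp X f = supp X f" if "continuous_map X (discrete_topology UNIV) f"
  proof -
    have "closedin X {x \<in> topspace X. f x \<in> - {0}}"
      by (rule closedin_continuous_map_preimage[OF that]) simp
    then show ?thesis by (simp add: closure_of_eq)
  qed
  then show ?thesis by (auto simp: Cc_group_def)
qed

lemma CcD:
  assumes "f \<in> Cc X"
  shows "continuous_map X (discrete_topology UNIV) f" "compactin X (supp X f)"
    "x \<notin> topspace X \<Longrightarrow> f x = 0"
  using assms by (auto simp: Cc_iff)

lemma Cc_zero: "(\<lambda>x. 0) \<in> Cc X"
  by (auto simp: Cc_iff)

lemma continuous_map_discrete_iff:
  "continuous_map X (discrete_topology UNIV) f \<longleftrightarrow>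
     (\<forall>x\<in>topspace X. \<exists>U. openin X U \<and> x \<in> U \<and> (\<forall>x'\<in>U. f x' = f x))"
proof
  assume f: "continuous_map X (discrete_topology UNIV) f"
  show "\<forall>x\<in>topspace X. \<exists>U. openin X U \<and> x \<in> U \<and> (\<forall>x'\<in>U. f x' = f x)"
  proof
    fix x assume "x \<in> topspace X"
    moreover have "openin X {x' \<in> topspace X. f x' \<in> {f x}}"
      by (rule openin_continuous_map_preimage[OF f]) simp
    ultimately show "\<exists>U. openin X U \<and> x \<in> U \<and> (\<forall>x'\<in>U. f x' = f x)" by blast
  qed
next
  assume R: "\<forall>x\<in>topspace X. \<exists>U. openin X U \<and> x \<in> U \<and> (\<forall>x'\<in>U. f x' = f x)"
  show "continuous_map X (discrete_topology UNIV) f"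
    unfolding continuous_map_def
  proof (intro conjI allI impI)
    fix V
    show "openin X {x \<in> topspace X. f x \<in> V}"
    proof (subst openin_subopen, intro ballI)
      fix x assume x: "x \<in> {x \<in> topspace X. f x \<in> V}"
      then obtain U where "openin X U" "x \<in> U" "\<forall>x'\<in>U. f x' = f x" using R by blast
      then show "\<exists>T. openin X T \<and> x \<in> T \<and> T \<subseteq> {x \<in> topspace X. f x \<in> V}"
        using x openin_subset by (intro exI[of _ U]) fastforce
    qed
  qed simp
qed

lemma Cc_combine:
  assumes f: "f \<in> Cc X" and g: "g \<in> Cc X" and F: "F 0 0 = 0"
  shows "(\<lambda>x. F (f x) (g x)) \<in> Cc X"
proof -
  have c: "continuous_map X (discrete_topology UNIV) (\<lambda>x. F (f x) (g x))"
    unfolding continuous_map_discrete_iff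
  proof
    fix x assume x: "x \<in> topspace X"
    obtain U where U: "openin X U" "x \<in> U" "\<forall>x'\<in>U. f x' = f x"
      using CcD(1)[OF f] x unfolding continuous_map_discrete_iff by blast
    obtain V where V: "openin X V" "x \<in> V" "\<forall>x'\<in>V. g x' = g x"
      using CcD(1)[OF g] x unfolding continuous_map_discrete_iff by blast
    have "\<forall>x'\<in>U \<inter> V. F (f x') (g x') = F (f x) (g x)" using U(3) V(3) by (metis IntD1 IntD2)
    then show "\<exists>U. openin X U \<and> x \<in> U \<and> (\<forall>x'\<in>U. F (f x') (g x') = F (f x) (g x))"
      using openin_Int[OF U(1) V(1)] U(2) V(2) by blast
  qed
  have "closedin X {x \<in> topspace X. F (f x) (g x) \<in> - {0}}"
    by (rule closedin_continuous_map_preimage[OF c]) simp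
  moreover have "compactin X (supp X f \<union> supp X g)"
    using f g by (intro compactin_Un) (auto dest: CcD)
  ultimately have "compactin X (supp X (\<lambda>x. F (f x) (g x)))"
    by (rule_tac closed_compactin[of X "supp X f \<union> supp X g"]) (use F in auto)
  then show ?thesis using c f g F by (auto simp: Cc_iff)
qed

lemma Cc_add: "f \<in> Cc X \<Longrightarrow> g \<in> Cc X \<Longrightarrow> (\<lambda>x. f x + g x) \<in> Cc X"
  using Cc_combine[of f X g "(+)"] by simp

lemma Cc_scale: "f \<in> Cc X \<Longrightarrow> (\<lambda>x. k * f x) \<in> Cc X"
  using Cc_combine[of f X f "\<lambda>a b. k * a"] by simp

lemma Cc_uminus: "f \<in> Cc X \<Longrightarrow> (\<lambda>x. - f x) \<in> Cc X"
  using Cc_scale[of f X "- 1"] by simp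

lemma Cc_sum:
  assumes "finite J" "\<And>j. j \<in> J \<Longrightarrow> F j \<in> Cc X"
  shows "(\<lambda>x. \<Sum>j\<in>J. k j * F j x) \<in> Cc X"
  using assms by (induction J rule: finite_induct) (auto simp: Cc_zero intro!: Cc_add Cc_scale)

lemma Cc_comm_group: "comm_group (Cc_group X)"
proof (rule comm_groupI)
  fix f assume f: "f \<in> Cc X"
  have "(\<lambda>x. - f x) \<in> Cc X" using Cc_scale[OF f, of "- 1"] by simp
  then show "\<exists>y\<in>Cc X. y \<otimes>\<^bsub>Cc_group X\<^esub> f = \<one>\<^bsub>Cc_group X\<^esub>"
    by (intro bexI[of _ "\<lambda>x. - f x"]) (auto simp: Cc_group_def)
next
  show "\<one>\<^bsub>Cc_group X\<^esub> \<in> Cc X" using Cc_zero[of X] by (simp add: Cc_group_def)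
next
  fix f g assume "f \<in> Cc X" "g \<in> Cc X"
  then show "f \<otimes>\<^bsub>Cc_group X\<^esub> g \<in> Cc X" using Cc_add[of f X g] by (simp add: Cc_group_def)
qed (auto simp: Cc_group_def add.assoc add.commute)

lemma Cc_subgroupI:
  assumes "H \<subseteq> Cc X" "(\<lambda>x. 0) \<in> H" "\<And>f g. f \<in> H \<Longrightarrow> g \<in> H \<Longrightarrow> (\<lambda>x. f x + g x) \<in> H"
    "\<And>f. f \<in> H \<Longrightarrow> (\<lambda>x. - f x) \<in> H"
  shows "subgroup H (Cc_group X)"
proof -
  interpret comm_group "Cc_group X" by (rule Cc_comm_group)
  show ?thesis
  proof (rule subgroupI)
    show "inv\<^bsub>Cc_group X\<^esub> f \<in> H" if f: "f \<in> H" for f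
    proof -
      have "inv\<^bsub>Cc_group X\<^esub> f = (\<lambda>x. - f x)"
        by (rule inv_equality) (use f assms(1) assms(4)[OF f] in \<open>auto simp: Cc_group_def\<close>)
      then show ?thesis using assms(4)[OF f] by simp
    qed
    show "f \<otimes>\<^bsub>Cc_group X\<^esub> g \<in> H" if "f \<in> H" "g \<in> H" for f g
      using assms(3)[OF that] by (simp add: Cc_group_def)
  qed (use assms in auto)
qed

lemma finite_fibre_supp:
  assumes "etale_map X Y \<pi>" "f \<in> Cc X"
  shows "finite {x \<in> topspace X. \<pi> x = y \<and> f x \<noteq> 0}"
proof -
  have "{x \<in> topspace X. \<pi> x = y \<and> f x \<noteq> 0} = {x \<in> supp X f. \<pi> x = y}" by auto
  then show ?thesis using etale_map_finite_fibre[OF assms(1) CcD(2)[OF assms(2)]] by simp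
qed

lemma pushforward_eq_sum:
  assumes "finite T" "T \<subseteq> {x \<in> topspace X. \<pi> x = y}" "{x \<in> topspace X. \<pi> x = y \<and> f x \<noteq> 0} \<subseteq> T"
  shows "pushforward X \<pi> f y = sum f T"
  unfolding pushforward_def by (rule sum.mono_neutral_left) (use assms in auto)

lemma pushforward_cong:
  assumes "\<And>x. x \<in> topspace X \<Longrightarrow> \<pi> x = \<pi>' x"
  shows "pushforward X \<pi> f = pushforward X \<pi>' f"
  unfolding pushforward_def by (intro ext sum.cong) (use assms in auto)

lemma pushforward_id:
  assumes "f \<in> Cc X"
  shows "pushforward X (\<lambda>x. x) f = f"
proof
  fix y
  show "pushforward X (\<lambda>x. x) f y = f y"
  proof (cases "y \<in> topspace X")
    case True
    then show ?thesis by (subst pushforward_eq_sum[where T = "{y}"]) auto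
  next
    case False
    then show ?thesis using CcD(3)[OF assms] by (subst pushforward_eq_sum[where T = "{}"]) auto
  qed
qed

lemma pushforward_sum:
  assumes \<pi>: "etale_map X Y \<pi>" and J: "finite J" and F: "\<And>j. j \<in> J \<Longrightarrow> F j \<in> Cc X"
  shows "pushforward X \<pi> (\<lambda>x. \<Sum>j\<in>J. k j * F j x) y = (\<Sum>j\<in>J. k j * pushforward X \<pi> (F j) y)"
proof -
  define T where "T = (\<Union>j\<in>J. {x \<in> topspace X. \<pi> x = y \<and> F j x \<noteq> 0})"
  have T: "finite T" "T \<subseteq> {x \<in> topspace X. \<pi> x = y}"
    unfolding T_def using J finite_fibre_supp[OF \<pi> F] by auto
  have "pushforward X \<pi> (\<lambda>x. \<Sum>j\<in>J. k j * F j x) y = (\<Sum>x\<in>T. \<Sum>j\<in>J. k j * F j x)"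
  proof (rule pushforward_eq_sum[OF T])
    show "{x \<in> topspace X. \<pi> x = y \<and> (\<Sum>j\<in>J. k j * F j x) \<noteq> 0} \<subseteq> T"
    proof safe
      fix x assume x: "x \<in> topspace X" "y = \<pi> x" "(\<Sum>j\<in>J. k j * F j x) \<noteq> 0"
      then obtain j where "j \<in> J" "k j * F j x \<noteq> 0" by (meson sum.not_neutral_contains_not_neutral)
      then show "x \<in> T" using x by (auto simp: T_def)
    qed
  qed
  also have "\<dots> = (\<Sum>j\<in>J. k j * sum (F j) T)"
    by (subst sum.swap) (simp add: sum_distrib_left)
  also have "\<dots> = (\<Sum>j\<in>J. k j * pushforward X \<pi> (F j) y)"
    by (intro sum.cong refl arg_cong2[where f = "(*)"] pushforward_eq_sum[symmetric, OF T]) (auto simp: T_def)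
  finally show ?thesis .
qed

lemma pushforward_add:
  assumes "etale_map X Y \<pi>" "f \<in> Cc X" "g \<in> Cc X"
  shows "pushforward X \<pi> (\<lambda>x. f x + g x) y = pushforward X \<pi> f y + pushforward X \<pi> g y"
  using pushforward_sum[of X Y \<pi> "{False, True}" "\<lambda>j. if j then f else g" "\<lambda>j. 1" y] assms
  by (auto simp: add.commute)

text \<open>Both sides are the sum of \<open>f\<close> over the finite part of the fibre of \<open>q \<circ> p\<close> where \<open>f\<close> does not
  vanish, on the left grouped by the values of \<open>p\<close>.\<close>

lemma pushforward_compose:
  assumes p: "etale_map X Y p" and q: "etale_map Y Z q" and f: "f \<in> Cc X"
  shows "pushforward Y q (pushforward X p f) = pushforward X (\<lambda>x. q (p x)) f"
proof
  fix z
  define A where "A = {x \<in> topspace X. q (p x) = z \<and> f x \<noteq> 0}"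
  have A: "finite A"
    unfolding A_def by (rule finite_fibre_supp[OF etale_map_compose[OF p q] f])
  have pY: "p x \<in> topspace Y" if "x \<in> topspace X" for x
    using etale_mapD(1)[OF p] that by (auto simp: continuous_map_def)
  have fib: "pushforward X p f y = (\<Sum>x | x \<in> A \<and> p x = y. f x)" if "q y = z" for y
    unfolding pushforward_def by (rule sum.cong) (use that in \<open>auto simp: A_def\<close>)
  have "pushforward Y q (pushforward X p f) z = (\<Sum>y\<in>p ` A. pushforward X p f y)"
  proof (rule pushforward_eq_sum)
    show "{y \<in> topspace Y. q y = z \<and> pushforward X p f y \<noteq> 0} \<subseteq> p ` A"
    proof safe
      fix y assume y: "y \<in> topspace Y" "z = q y" "pushforward X p f y \<noteq> 0"
      then have "(\<Sum>x | x \<in> A \<and> p x = y. f x) \<noteq> 0" using fib by simp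
      then obtain x where "x \<in> A \<and> p x = y"
        by (metis (mono_tags, lifting) mem_Collect_eq sum.not_neutral_contains_not_neutral)
      then show "y \<in> p ` A" by auto
    qed
  qed (use A pY in \<open>auto simp: A_def\<close>)
  also have "\<dots> = (\<Sum>y\<in>p ` A. \<Sum>x | x \<in> A \<and> p x = y. f x)"
    by (intro sum.cong refl fib) (auto simp: A_def)
  also have "\<dots> = sum f A" using sum.image_gen[OF A, of f p] by simp
  also have "\<dots> = pushforward X (\<lambda>x. q (p x)) f z"
    unfolding pushforward_def A_def by simp
  finally show "pushforward Y q (pushforward X p f) z = pushforward X (\<lambda>x. q (p x)) f z" .
qed

lemma Hausdorff_separate_finite:
  assumes X: "Hausdorff_space X" and F: "finite F" "F \<subseteq> topspace X"
  obtains D where "\<And>x. x \<in> F \<Longrightarrow> openin X (D x) \<and> x \<in> D x"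
    and "\<And>x x'. x \<in> F \<Longrightarrow> x' \<in> F \<Longrightarrow> x \<noteq> x' \<Longrightarrow> D x \<inter> D x' = {}"
proof -
  have "\<forall>x x'. \<exists>U V. x \<in> topspace X \<and> x' \<in> topspace X \<and> x \<noteq> x' \<longrightarrow>
      openin X U \<and> openin X V \<and> x \<in> U \<and> x' \<in> V \<and> disjnt U V"
    using X unfolding Hausdorff_space_def by blast
  then obtain P Q where PQ: "\<And>x x'. x \<in> topspace X \<and> x' \<in> topspace X \<and> x \<noteq> x' \<Longrightarrow>
      openin X (P x x') \<and> openin X (Q x x') \<and> x \<in> P x x' \<and> x' \<in> Q x x' \<and> disjnt (P x x') (Q x x')"
    by metis
  define D where "D x = topspace X \<inter> \<Inter>((\<lambda>x'. P x x' \<inter> Q x' x) ` (F - {x}))" for x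
  show thesis
  proof
    fix x assume x: "x \<in> F"
    show "openin X (D x) \<and> x \<in> D x"
    proof
      have "openin X (P x x' \<inter> Q x' x) \<and> x \<in> P x x' \<inter> Q x' x" if "x' \<in> F - {x}" for x'
        using PQ[of x x'] PQ[of x' x] that x F(2) by auto
      then show "openin X (D x)" "x \<in> D x"
        unfolding D_def using F x by (auto intro!: openin_Int_Inter)
    qed
  next
    fix x x' assume x: "x \<in> F" "x' \<in> F" "x \<noteq> x'"
    then have "disjnt (P x x') (Q x x')" using PQ[of x x'] F(2) by auto
    moreover have "D x \<subseteq> P x x'" "D x' \<subseteq> Q x x'" using x by (auto simp: D_def)
    ultimately show "D x \<inter> D x' = {}" by (auto simp: disjnt_def)
  qed
qed

text \<open>Let \<open>x\<^sub>1, \<dots>, x\<^sub>k\<close> be the points over \<open>y\<close> where \<open>f\<close> does not vanish. Choose disjoint open sets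
  \<open>U\<^sub>i \<ni> x\<^sub>i\<close> on which \<open>\<pi>\<close> is injective and \<open>f\<close> is constant. The rest of the support is compact and
  misses the fibre, so its image is closed and does not contain \<open>y\<close>. On the intersection of the
  \<open>\<pi>(U\<^sub>i)\<close> minus that image, every fibre meets the support in exactly one point of each \<open>U\<^sub>i\<close> and
  in no other point, so the pushforward is constant.\<close>

lemma pushforward_in_Cc:
  assumes \<pi>: "etale_map X Y \<pi>" and X: "Hausdorff_space X" and Y: "Hausdorff_space Y" and f: "f \<in> Cc X"
  shows "pushforward X \<pi> f \<in> Cc Y"
proof -
  let ?S = "supp X f"
  let ?g = "pushforward X \<pi> f"
  have cl: "closedin X ?S"
    using compactin_imp_closedin X CcD(2)[OF f] by blast
  have c: "continuous_map Y (discrete_topology UNIV) ?g"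
    unfolding continuous_map_discrete_iff
  proof
    fix y assume y: "y \<in> topspace Y"
    define F where "F = {x \<in> topspace X. \<pi> x = y \<and> f x \<noteq> 0}"
    have F: "finite F" "F \<subseteq> topspace X"
      using finite_fibre_supp[OF \<pi> f] by (auto simp: F_def)
    obtain D where D: "\<And>x. x \<in> F \<Longrightarrow> openin X (D x) \<and> x \<in> D x"
      and Ddisj: "\<And>x x'. x \<in> F \<Longrightarrow> x' \<in> F \<Longrightarrow> x \<noteq> x' \<Longrightarrow> D x \<inter> D x' = {}"
      using Hausdorff_separate_finite[OF X F] by blast
    have "\<exists>U. openin X U \<and> x \<in> U \<and> U \<subseteq> D x \<and> inj_on \<pi> U \<and> (\<forall>x'\<in>U. f x' = f x)" if "x \<in> F" for x
    proof -
      have x: "x \<in> topspace X" using F(2) that by blast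
      obtain U where U: "openin X U" "x \<in> U" "inj_on \<pi> U" using etale_mapD(3)[OF \<pi> x] by blast
      obtain V where V: "openin X V" "x \<in> V" "\<forall>x'\<in>V. f x' = f x"
        using CcD(1)[OF f] x unfolding continuous_map_discrete_iff by blast
      have "inj_on \<pi> (D x \<inter> U \<inter> V)" using U(3) by (rule inj_on_subset) blast
      moreover have "openin X (D x \<inter> U \<inter> V)" using D[OF that] U(1) V(1) by blast
      ultimately show ?thesis using D[OF that] U(2) V(2,3)
        by (intro exI[of _ "D x \<inter> U \<inter> V"]) blast
    qed
    then obtain U where U0: "\<And>x. x \<in> F \<Longrightarrow> openin X (U x) \<and> x \<in> U x \<and> U x \<subseteq> D x \<and>
       inj_on \<pi> (U x) \<and> (\<forall>x'\<in>U x. f x' = f x)"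
      by metis
    have U: "openin X (U x)" "x \<in> U x" "inj_on \<pi> (U x)" if "x \<in> F" for x
      using U0[OF that] by blast+
    define R where "R = ?S - \<Union>(U ` F)"
    have "closedin X R" unfolding R_def using cl U by (intro closedin_diff) auto
    then have "compactin X R"
      by (rule_tac closed_compactin[OF CcD(2)[OF f]]) (auto simp: R_def)
    then have "closedin Y (\<pi> ` R)"
      using compactin_imp_closedin[OF Y] image_compactin etale_mapD(1)[OF \<pi>] by metis
    moreover have "openin Y (\<pi> ` U x)" if "x \<in> F" for x
      using U[OF that] etale_mapD(2)[OF \<pi>] by (auto simp: open_map_def)
    ultimately have op: "openin Y ((topspace Y \<inter> \<Inter>((\<lambda>x. \<pi> ` U x) ` F)) - \<pi> ` R)" (is "openin Y ?W")
      using F(1) by (intro openin_diff openin_Int_Inter) auto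
    have "y \<notin> \<pi> ` R"
    proof
      assume "y \<in> \<pi> ` R"
      then obtain x where "x \<in> ?S" "\<pi> x = y" "x \<notin> \<Union>(U ` F)" by (auto simp: R_def)
      then show False using U(2)[of x] by (auto simp: F_def)
    qed
    then have yW: "y \<in> ?W" using y U(2) by (force simp: F_def)
    have "?g y' = ?g y" if y': "y' \<in> ?W" for y'
    proof -
      \<comment> \<open>\<open>\<sigma>\<close> transports the support in the fibre of \<open>y\<close> to the support in the fibre of \<open>y'\<close>.\<close>
      have "\<exists>x'. x' \<in> U x \<and> \<pi> x' = y'" if "x \<in> F" for x using y' that by auto
      then obtain \<sigma> where \<sigma>: "\<And>x. x \<in> F \<Longrightarrow> \<sigma> x \<in> U x \<and> \<pi> (\<sigma> x) = y'" by metis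
      have inj: "inj_on \<sigma> F"
        unfolding inj_on_def using \<sigma> U0 Ddisj by (metis disjoint_iff subsetD)
      have f\<sigma>: "f (\<sigma> x) = f x" if "x \<in> F" for x using \<sigma>[OF that] U0[OF that] by blast
      have "?g y' = sum f (\<sigma> ` F)"
      proof (rule pushforward_eq_sum)
        have "\<sigma> x \<in> topspace X" if "x \<in> F" for x
          using \<sigma>[OF that] U[OF that] openin_subset by blast
        then show "\<sigma> ` F \<subseteq> {x \<in> topspace X. \<pi> x = y'}" using \<sigma> by auto
        show "{x \<in> topspace X. \<pi> x = y' \<and> f x \<noteq> 0} \<subseteq> \<sigma> ` F"
        proof safe
          fix x assume x: "x \<in> topspace X" "y' = \<pi> x" "f x \<noteq> 0"
          then have "x \<notin> R" using y' by auto
          then obtain z where z: "z \<in> F" "x \<in> U z" using x by (auto simp: R_def)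
          then have "x = \<sigma> z" using U(3)[OF z(1)] \<sigma>[OF z(1)] x(2) z(2) by (auto simp: inj_on_def)
          then show "x \<in> \<sigma> ` F" using z by blast
        qed
      qed (use F in auto)
      also have "\<dots> = sum f F" by (simp add: sum.reindex[OF inj] f\<sigma>)
      also have "\<dots> = ?g y" unfolding pushforward_def F_def by simp
      finally show ?thesis .
    qed
    then show "\<exists>U. openin Y U \<and> y \<in> U \<and> (\<forall>y'\<in>U. ?g y' = ?g y)" using op yW by blast
  qed
  have pY: "\<pi> x \<in> topspace Y" if "x \<in> topspace X" for x
    using etale_mapD(1)[OF \<pi>] that by (auto simp: continuous_map_def)
  have nz: "\<exists>x\<in>?S. \<pi> x = y" if "?g y \<noteq> 0" for y
    using that unfolding pushforward_def
    by (metis (mono_tags, lifting) mem_Collect_eq sum.not_neutral_contains_not_neutral)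
  have "closedin Y {y \<in> topspace Y. ?g y \<in> - {0}}"
    by (rule closedin_continuous_map_preimage[OF c]) simp
  moreover have "compactin Y (\<pi> ` ?S)"
    by (rule image_compactin[OF CcD(2)[OF f] etale_mapD(1)[OF \<pi>]])
  ultimately have "compactin Y (supp Y ?g)"
    by (rule_tac closed_compactin[of Y "\<pi> ` ?S"]) (use nz in fastforce)+
  moreover have "?g y = 0" if "y \<notin> topspace Y" for y
    using nz[of y] that pY by auto
  ultimately show ?thesis using c by (auto simp: Cc_iff)
qed

section \<open>Two double sums and a subquotient\<close>

text \<open>The combinatorics of \<open>\<partial>\<partial> = 0\<close>: the substitution \<open>(i, j) \<mapsto> (j - 1, i)\<close> exchanges the terms with
  \<open>i < j\<close> and those with \<open>j \<le> i\<close>, and reverses their signs.\<close>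

lemma alternating_double_sum_cancels:
  fixes P :: "nat \<Rightarrow> nat \<Rightarrow> int"
  assumes "\<And>i j. i < j \<Longrightarrow> j \<le> Suc m \<Longrightarrow> P i j = P (j - 1) i"
  shows "(\<Sum>i\<le>m. \<Sum>j\<le>Suc m. (- 1) ^ i * ((- 1) ^ j * P i j)) = 0"
proof -
  let ?t = "\<lambda>(i, j). (- 1) ^ i * ((- 1) ^ j * P i j)"
  let ?A = "{(i, j). i \<le> m \<and> j \<le> Suc m \<and> i < j}"
  let ?B = "{(i, j). i \<le> m \<and> j \<le> Suc m \<and> j \<le> i}"
  have fin: "finite ?A" "finite ?B"
    by (rule finite_subset[of _ "{..m} \<times> {..Suc m}"]; auto)+
  have "(\<Sum>i\<le>m. \<Sum>j\<le>Suc m. (- 1) ^ i * ((- 1) ^ j * P i j)) = sum ?t ({..m} \<times> {..Suc m})"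
    by (simp only: sum.cartesian_product)
  also have "{..m} \<times> {..Suc m} = ?A \<union> ?B" by auto
  also have "sum ?t (?A \<union> ?B) = sum ?t ?A + sum ?t ?B"
    by (rule sum.union_disjoint[OF fin]) auto
  also have "sum ?t ?A = sum (\<lambda>p. - ?t p) ?B"
  proof (rule sum.reindex_bij_witness[of _ "\<lambda>(i, j). (j, Suc i)" "\<lambda>(i, j). (j - 1, i)"])
    fix a assume "a \<in> ?A"
    then obtain i j where a: "a = (i, Suc j)" "i \<le> j" "j \<le> m"
      by (cases a; cases "snd a") auto
    then show "- (case case a of (i, j) \<Rightarrow> (j - 1, i) of (i, j) \<Rightarrow> (- 1) ^ i * ((- 1) ^ j * P i j)) = (case a of (i, j) \<Rightarrow> (- 1) ^ i * ((- 1) ^ j * P i j))"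
      using assms[of i "Suc j"] by simp
  qed auto
  finally show ?thesis by (simp add: sum_negf)
qed

text \<open>The combinatorics of \<open>\<partial>h + h\<partial> = id - \<phi>\<close>, where \<open>Q i j\<close> stands for \<open>d\<^sub>i h\<^sub>j\<close> and \<open>R j i\<close> for
  \<open>h\<^sub>j d\<^sub>i\<close>. Terms off the two diagonals \<open>i = j\<close> and \<open>i = j + 1\<close> cancel against \<open>h\<partial>\<close>; the two diagonals
  enter with opposite signs and telescope to the two end terms.\<close>

lemma homotopy_double_sum:
  fixes Q R :: "nat \<Rightarrow> nat \<Rightarrow> int"
  assumes lt: "\<And>i j. i < j \<Longrightarrow> j \<le> n \<Longrightarrow> Q i j = R (j - 1) i"
    and gt: "\<And>i j. Suc j < i \<Longrightarrow> i \<le> Suc n \<Longrightarrow> Q i j = R j (i - 1)"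
    and diag: "\<And>j. j < n \<Longrightarrow> Q (Suc j) (Suc j) = Q (Suc j) j"
  shows "(\<Sum>i\<le>Suc n. \<Sum>j\<le>n. (- 1) ^ i * ((- 1) ^ j * Q i j))
       + (\<Sum>j<n. \<Sum>i\<le>n. (- 1) ^ j * ((- 1) ^ i * R j i)) = Q 0 0 - Q (Suc n) n"
proof -
  let ?t = "\<lambda>(i, j). (- 1) ^ i * ((- 1) ^ j * Q i j)"
  let ?r = "\<lambda>(j, i). (- 1) ^ j * ((- 1) ^ i * R j i)"
  \<comment> \<open>\<open>?A\<close> and \<open>?B\<close> are the parts off the two diagonals \<open>?D\<close> and \<open>?E\<close>; they cancel against \<open>?A'\<close> and
    \<open>?B'\<close>, the two halves of the second sum.\<close>
  let ?A = "{(i, j). j \<le> n \<and> i < j}"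
  let ?B = "{(i, j). i \<le> Suc n \<and> Suc j < i}"
  let ?D = "(\<lambda>j. (j, j)) ` {..n}"
  let ?E = "(\<lambda>j. (Suc j, j)) ` {..n}"
  let ?A' = "{(j, i). j < n \<and> i \<le> j}"
  let ?B' = "{(j, i). j < i \<and> i \<le> n}"
  have fin: "finite ?A" "finite ?B" "finite ?D" "finite ?E" "finite (?D \<union> ?E)" "finite (?B \<union> (?D \<union> ?E))"
    by ((rule finite_subset[of _ "{..Suc n} \<times> {..n}"]; auto)+)
  have fin': "finite ?A'" "finite ?B'"
    by ((rule finite_subset[of _ "{..n} \<times> {..n}"]; auto)+)
  have dec: "{..Suc n} \<times> {..n} = ?A \<union> (?B \<union> (?D \<union> ?E))" by (auto simp: image_iff)
  have dec': "{..<n} \<times> {..n} = ?A' \<union> ?B'" by auto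
  have "(\<Sum>i\<le>Suc n. \<Sum>j\<le>n. (- 1) ^ i * ((- 1) ^ j * Q i j)) = sum ?t ({..Suc n} \<times> {..n})"
    by (simp only: sum.cartesian_product)
  also have "\<dots> = sum ?t ?A + (sum ?t ?B + (sum ?t ?D + sum ?t ?E))"
    unfolding dec using fin by (subst sum.union_disjoint; auto)+
  finally have 1: "(\<Sum>i\<le>Suc n. \<Sum>j\<le>n. (- 1) ^ i * ((- 1) ^ j * Q i j))
    = sum ?t ?A + (sum ?t ?B + (sum ?t ?D + sum ?t ?E))" .
  have "(\<Sum>j<n. \<Sum>i\<le>n. (- 1) ^ j * ((- 1) ^ i * R j i)) = sum ?r ({..<n} \<times> {..n})"
    by (simp only: sum.cartesian_product)
  also have "\<dots> = sum ?r ?A' + sum ?r ?B'"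
    unfolding dec' using fin' by (subst sum.union_disjoint) auto
  finally have 2: "(\<Sum>j<n. \<Sum>i\<le>n. (- 1) ^ j * ((- 1) ^ i * R j i)) = sum ?r ?A' + sum ?r ?B'" .
  have 3: "sum ?t ?A = sum (\<lambda>p. - ?r p) ?A'"
  proof (rule sum.reindex_bij_witness[of _ "\<lambda>(j, i). (i, Suc j)" "\<lambda>(i, j). (j - 1, i)"])
    fix a assume "a \<in> ?A"
    then obtain i j where a: "a = (i, Suc j)" "i \<le> j" "Suc j \<le> n"
      by (cases a; cases "snd a") auto
    then show "- (case case a of (i, j) \<Rightarrow> (j - 1, i) of (j, i) \<Rightarrow> (- 1) ^ j * ((- 1) ^ i * R j i)) = (case a of (i, j) \<Rightarrow> (- 1) ^ i * ((- 1) ^ j * Q i j))"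
      using lt[of i "Suc j"] by simp
  qed auto
  have 4: "sum ?t ?B = sum (\<lambda>p. - ?r p) ?B'"
  proof (rule sum.reindex_bij_witness[of _ "\<lambda>(j, i). (Suc i, j)" "\<lambda>(i, j). (j, i - 1)"])
    fix a assume "a \<in> ?B"
    then obtain i j where a: "a = (Suc i, j)" "j < i" "i \<le> n"
      by (cases a; cases "fst a") auto
    then show "- (case case a of (i, j) \<Rightarrow> (j, i - 1) of (j, i) \<Rightarrow> (- 1) ^ j * ((- 1) ^ i * R j i)) = (case a of (i, j) \<Rightarrow> (- 1) ^ i * ((- 1) ^ j * Q i j))"
      using gt[of j "Suc i"] by simp
  qed auto
  have sq: "(- 1) ^ j * ((- 1) ^ j * x) = x" for j and x :: int
    by (simp add: mult.assoc[symmetric] power_mult_distrib[symmetric])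
  have 5: "sum ?t ?D = (\<Sum>j\<le>n. Q j j)"
    by (subst sum.reindex) (auto simp: inj_on_def sq)
  have 6: "sum ?t ?E = - (\<Sum>j\<le>n. Q (Suc j) j)"
    by (subst sum.reindex) (auto simp: inj_on_def sq sum_negf)
  have 7: "(\<Sum>j\<le>n. Q j j) = Q 0 0 + (\<Sum>j<n. Q (Suc j) j)"
    unfolding sum.atMost_shift using diag by simp
  have 8: "(\<Sum>j\<le>n. Q (Suc j) j) = (\<Sum>j<n. Q (Suc j) j) + Q (Suc n) n"
    by (simp add: lessThan_Suc_atMost[symmetric])
  show ?thesis unfolding 1 2 3 4 5 6 7 8 by (simp add: sum_negf)
qed

text \<open>The first isomorphism theorem for the composite of \<open>\<phi>\<close> with the quotient map of \<open>ZB\<close>.\<close>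

lemma subquotient_iso:
  fixes A :: "('x, 'm) monoid_scheme" and B :: "('y, 'l) monoid_scheme"
  assumes A: "comm_group A" and B: "comm_group B" and \<phi>: "\<phi> \<in> hom A B"
    and ZA: "subgroup ZA A" and ZB: "subgroup ZB B" and BB: "subgroup BB B" "BB \<subseteq> ZB"
    and im: "\<phi> ` ZA = ZB" and ker: "\<And>z. z \<in> ZA \<Longrightarrow> \<phi> z \<in> BB \<longleftrightarrow> z \<in> BA" and BA: "BA \<subseteq> ZA"
  shows "(A\<lparr>carrier := ZA\<rparr> Mod BA) \<cong> (B\<lparr>carrier := ZB\<rparr> Mod BB)"
proof -
  let ?A = "A\<lparr>carrier := ZA\<rparr>" and ?B = "B\<lparr>carrier := ZB\<rparr>"
  interpret A: comm_group A by (rule A)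
  interpret B: comm_group B by (rule B)
  have gA: "comm_group ?A"
    using subgroup.subgroup_is_group[OF ZA A.group_axioms] subgroup.subset[OF ZA]
    by (intro group.group_comm_groupI) (auto intro: A.m_comm)
  have gB: "comm_group ?B"
    using subgroup.subgroup_is_group[OF ZB B.group_axioms] subgroup.subset[OF ZB]
    by (intro group.group_comm_groupI) (auto intro: B.m_comm)
  have "subgroup BB ?B"
    using group.subgroup_incl[OF comm_group.axioms(2)[OF B] BB(1) ZB BB(2)] .
  then have n: "BB \<lhd> ?B" using comm_group.subgroup_imp_normal[OF gB] by blast
  have h1: "\<phi> \<in> hom ?A ?B"
    using \<phi> im subgroup.subset[OF ZA] by (auto simp: hom_def)
  have h2: "(\<lambda>a. BB #>\<^bsub>?B\<^esub> a) \<in> hom ?B (?B Mod BB)"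
    using normal.r_coset_hom_Mod[OF n] .
  have h: "(\<lambda>a. BB #>\<^bsub>?B\<^esub> \<phi> a) \<in> hom ?A (?B Mod BB)"
    using hom_compose[OF h1 h2] by (simp add: o_def)
  interpret gh: group_hom ?A "?B Mod BB" "\<lambda>a. BB #>\<^bsub>?B\<^esub> \<phi> a"
    using h gA n by (simp add: group_hom_def group_hom_axioms_def comm_group_def normal.factorgroup_is_group)
  have "BB #>\<^bsub>?B\<^esub> b = BB \<longleftrightarrow> b \<in> BB" if "b \<in> ZB" for b
  proof
    interpret gB: comm_group ?B by (rule gB)
    assume "BB #>\<^bsub>?B\<^esub> b = BB"
    then show "b \<in> BB"
      using gB.rcos_self[of b BB] that \<open>subgroup BB ?B\<close> by simp
  next
    interpret gB: comm_group ?B by (rule gB)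
    assume "b \<in> BB"
    then show "BB #>\<^bsub>?B\<^esub> b = BB"
      using subgroup.rcos_const[OF \<open>subgroup BB ?B\<close> gB.group_axioms] by blast
  qed
  then have k: "kernel ?A (?B Mod BB) (\<lambda>a. BB #>\<^bsub>?B\<^esub> \<phi> a) = BA"
    using ker im BA by (auto simp: kernel_def FactGroup_def)
  have "(\<lambda>a. BB #>\<^bsub>?B\<^esub> \<phi> a) ` carrier ?A = carrier (?B Mod BB)"
    using im by (auto simp: FactGroup_def RCOSETS_def)
  from gh.FactGroup_iso[OF this] show ?thesis unfolding k .
qed

section \<open>Etale groupoids\<close>

context groupoid
begin

lemma src_inv: "g \<in> garr G \<Longrightarrow> gsrc G (ginv G g) = grng G g"
  by (simp add: gsrc_def grng_def inv_inv)

lemma rng_inv: "g \<in> garr G \<Longrightarrow> grng G (ginv G g) = gsrc G g"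
  by (simp add: gsrc_def grng_def inv_inv)

lemma composable_inv_left: "g \<in> garr G \<Longrightarrow> composable G (ginv G g) g"
  by (simp add: composable_def src_inv inv_closed)

lemma composable_inv_right: "g \<in> garr G \<Longrightarrow> composable G g (ginv G g)"
  by (simp add: composable_def rng_inv inv_closed)

lemma src_closed: "g \<in> garr G \<Longrightarrow> gsrc G g \<in> garr G"
  using mult_closed[OF composable_inv_left] by (simp add: gsrc_def)

lemma rng_closed: "g \<in> garr G \<Longrightarrow> grng G g \<in> garr G"
  using mult_closed[OF composable_inv_right] by (simp add: grng_def)

lemma src_src: "g \<in> garr G \<Longrightarrow> gsrc G (gsrc G g) = gsrc G g"
  using src_mult[OF composable_inv_left] by (simp add: gsrc_def)

lemma rng_src: "g \<in> garr G \<Longrightarrow> grng G (gsrc G g) = gsrc G g"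
  using rng_mult[OF composable_inv_left, of g] by (simp add: gsrc_def[of _ g] rng_inv)

lemma src_rng: "g \<in> garr G \<Longrightarrow> gsrc G (grng G g) = grng G g"
  using src_mult[OF composable_inv_right, of g] by (simp add: grng_def[of _ g] src_inv)

lemma rng_rng: "g \<in> garr G \<Longrightarrow> grng G (grng G g) = grng G g"
  using rng_mult[OF composable_inv_right, of g] by (simp add: grng_def[of _ g])

lemma mult_src: "g \<in> garr G \<Longrightarrow> gmult G g (gsrc G g) = g"
  using inv_mult_cancel[OF composable_inv_left, of g] by (simp add: gsrc_def inv_inv)

lemma rng_mult_self: "g \<in> garr G \<Longrightarrow> gmult G (grng G g) g = g"
  using mult_inv_cancel[OF composable_inv_right, of g] by (simp add: grng_def inv_inv)

lemma gunits_iff: "u \<in> gunits G \<longleftrightarrow> u \<in> garr G \<and> gsrc G u = u"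
  by (auto simp: gunits_def src_closed src_src intro: image_eqI[of u "gsrc G" u])

lemma src_in_gunits: "g \<in> garr G \<Longrightarrow> gsrc G g \<in> gunits G"
  by (simp add: gunits_def)

lemma rng_in_gunits: "g \<in> garr G \<Longrightarrow> grng G g \<in> gunits G"
  by (simp add: gunits_iff src_rng rng_closed)

lemma rng_unit: "u \<in> gunits G \<Longrightarrow> grng G u = u"
  by (metis gunits_iff rng_src)

lemma src_unit: "u \<in> gunits G \<Longrightarrow> gsrc G u = u"
  by (simp add: gunits_iff)

lemma topspace_unit_space: "topspace (unit_space G) = gunits G"
  by (auto simp: unit_space_def gunits_iff garr_def)

end

context topological_groupoid
begin

lemma continuous_map_gmult:
  assumes f: "continuous_map X (gtop G) f" and g: "continuous_map X (gtop G) g"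
    and c: "\<And>x. x \<in> topspace X \<Longrightarrow> composable G (f x) (g x)"
  shows "continuous_map X (gtop G) (\<lambda>x. gmult G (f x) (g x))"
proof -
  have "continuous_map X (prod_topology (gtop G) (gtop G)) (\<lambda>x. (f x, g x))"
    using f g by (simp add: continuous_map_paired)
  then have "continuous_map X (subtopology (prod_topology (gtop G) (gtop G)) {(g, h). composable G g h}) (\<lambda>x. (f x, g x))"
    using c by (auto simp: continuous_map_in_subtopology)
  from continuous_map_compose[OF this continuous_mult] show ?thesis by (simp add: o_def)
qed

lemma continuous_map_ginv:
  "continuous_map X (gtop G) f \<Longrightarrow> continuous_map X (gtop G) (\<lambda>x. ginv G (f x))"
  using continuous_map_compose[OF _ continuous_inv] by (simp add: o_def)

lemma continuous_map_garr: "continuous_map X (gtop G) f \<Longrightarrow> x \<in> topspace X \<Longrightarrow> f x \<in> garr G"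
  by (auto simp: continuous_map_def garr_def)

lemma continuous_map_gsrc:
  assumes "continuous_map X (gtop G) f"
  shows "continuous_map X (gtop G) (\<lambda>x. gsrc G (f x))"
  unfolding gsrc_def using assms
  by (intro continuous_map_gmult continuous_map_ginv) (auto intro: composable_inv_left continuous_map_garr)

lemma continuous_map_grng:
  assumes "continuous_map X (gtop G) f"
  shows "continuous_map X (gtop G) (\<lambda>x. grng G (f x))"
  unfolding grng_def using assms
  by (intro continuous_map_gmult continuous_map_ginv) (auto intro: composable_inv_right continuous_map_garr)

end

text \<open>The hypotheses on a groupoid from which its chain complex is built. They are inherited by the
  skew product and by the identity component.\<close>

locale Hausdorff_etale_groupoid = topological_groupoid G for G :: "'a top_groupoid" +
  assumes Hausdorff_gtop: "Hausdorff_space (gtop G)"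
    and etale_src: "etale_map (gtop G) (unit_space G) (gsrc G)"

section \<open>The nerve and its face maps\<close>

text \<open>A string \<open>(g\<^sub>1, \<dots>, g\<^sub>n)\<close> passes through the objects \<open>r(g\<^sub>1), s(g\<^sub>1), \<dots>, s(g\<^sub>n)\<close>, numbered from \<open>0\<close>
  to \<open>n\<close>. For \<open>n = 0\<close> the entry \<open>g\<^sub>1\<close> is a unit, equal to its own range, so the formula for vertex
  \<open>0\<close> applies there too.\<close>

definition vertex :: "'a top_groupoid \<Rightarrow> nat \<Rightarrow> (nat \<Rightarrow> 'a) \<Rightarrow> 'a"
  where "vertex G i g = (if i = 0 then grng G (g 1) else gsrc G (g i))"

text \<open>An element of the nerve in degree \<open>0\<close>, where a unit is a string with one entry.\<close>

definition last_vertex :: "'a top_groupoid \<Rightarrow> nat \<Rightarrow> (nat \<Rightarrow> 'a) \<Rightarrow> nat \<Rightarrow> 'a"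
  where "last_vertex G n g = (\<lambda>j\<in>{1}. if n = 0 then g 1 else gsrc G (g n))"

text \<open>In degree one the boundary is made from the source and the range instead of \<open>face\<close>. Counting
  these two maps as the faces of an arrow gives the boundary and the simplicial identities the same
  form in all degrees.\<close>

definition face_map :: "'a top_groupoid \<Rightarrow> nat \<Rightarrow> nat \<Rightarrow> (nat \<Rightarrow> 'a) \<Rightarrow> nat \<Rightarrow> 'a"
  where "face_map G n i g =
    (if n = 0 then \<lambda>j\<in>{1}. if i = 0 then gsrc G (g 1) else grng G (g 1)
     else face G (Suc n) i g)"

lemma face_map_0: "face_map G 0 i g = (\<lambda>j\<in>{1}. if i = 0 then gsrc G (g 1) else grng G (g 1))"
  by (simp add: face_map_def)

lemma face_map_pos: "n > 0 \<Longrightarrow> face_map G n i g =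
    (\<lambda>j\<in>{1..n}. if j < i then g j else if j = i then gmult G (g i) (g (Suc i)) else g (Suc j))"
  by (simp add: face_map_def face_def)

text \<open>With \<open>face_map\<close>, degree one is no longer an exception in the definition of the boundary.\<close>

lemma boundary_eq:
  "boundary G (Suc n) f y = (\<Sum>i\<le>Suc n. (- 1) ^ i * pushforward (nerve G (Suc n)) (face_map G n i) f y)"
proof (cases "n = 0")
  case True
  have "face_map G 0 0 = (\<lambda>g. \<lambda>j\<in>{1}. gsrc G (g j))" "face_map G 0 1 = (\<lambda>g. \<lambda>j\<in>{1}. grng G (g j))"
    by (auto simp: face_map_0 intro!: ext)
  then show ?thesis using True by (simp add: boundary_def)
next
  case False
  then have "face_map G n i = face G (Suc n) i" for i by (intro ext) (simp add: face_map_def)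
  then show ?thesis using False by (simp add: boundary_def atLeast0AtMost)
qed

context Hausdorff_etale_groupoid
begin

text \<open>One description for all degrees, in which the exceptional case \<open>n = 0\<close> is only a side condition.
  It reduces continuity of a map into a nerve to continuity of its entries.\<close>

lemma nerve_eq:
  "nerve G n = subtopology (product_topology (\<lambda>_. gtop G) {1..max 1 n})
     {g. (\<forall>i. 1 \<le> i \<and> i < n \<longrightarrow> composable G (g i) (g (Suc i))) \<and> (n = 0 \<longrightarrow> g 1 \<in> gunits G)}"
proof (cases "n = 0")
  case True
  let ?P = "product_topology (\<lambda>_. gtop G) {1::nat}"
  have "nerve G n = subtopology ?P (PiE {1} (\<lambda>_. gunits G))"
    using True by (simp add: nerve_def unit_space_def subtopology_product_topology)
  also have "\<dots> = subtopology ?P (topspace ?P \<inter> PiE {1} (\<lambda>_. gunits G))"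
    by (simp only: subtopology_restrict)
  also have "topspace ?P \<inter> PiE {1} (\<lambda>_. gunits G) = topspace ?P \<inter> {g. g 1 \<in> gunits G}"
    by (auto simp: PiE_iff)
  also have "subtopology ?P \<dots> = subtopology ?P {g. g 1 \<in> gunits G}"
    by (simp only: subtopology_restrict)
  finally show ?thesis using True by simp
next
  case False
  then have "max 1 n = n" by simp
  with False show ?thesis by (simp add: nerve_def)
qed

lemma nerve_iff:
  "g \<in> topspace (nerve G n) \<longleftrightarrow> g \<in> extensional {1..max 1 n} \<and> (\<forall>j\<in>{1..max 1 n}. g j \<in> garr G) \<and>
     (\<forall>i. 1 \<le> i \<and> i < n \<longrightarrow> composable G (g i) (g (Suc i))) \<and> (n = 0 \<longrightarrow> g 1 \<in> gunits G)"
  by (auto simp: nerve_eq PiE_iff garr_def)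

lemma nerve_garr: "g \<in> topspace (nerve G n) \<Longrightarrow> 1 \<le> j \<Longrightarrow> j \<le> max 1 n \<Longrightarrow> g j \<in> garr G"
  by (simp add: nerve_iff)

lemma nerve_composable:
  "g \<in> topspace (nerve G n) \<Longrightarrow> 1 \<le> j \<Longrightarrow> j < n \<Longrightarrow> composable G (g j) (g (Suc j))"
  by (simp add: nerve_iff)

lemma Hausdorff_nerve: "Hausdorff_space (nerve G n)"
  unfolding nerve_eq by (intro Hausdorff_space_subtopology) (simp add: Hausdorff_space_product_topology Hausdorff_gtop)

lemma continuous_map_nerve_proj:
  assumes "j \<in> {1..max 1 n}"
  shows "continuous_map (nerve G n) (gtop G) (\<lambda>g. g j)"
  unfolding nerve_eq
  by (intro continuous_map_from_subtopology continuous_map_product_projection assms)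

lemma continuous_map_into_nerve:
  assumes "\<And>x. x \<in> topspace X \<Longrightarrow> f x \<in> topspace (nerve G n)"
    and "\<And>j. j \<in> {1..max 1 n} \<Longrightarrow> continuous_map X (gtop G) (\<lambda>x. f x j)"
  shows "continuous_map X (nerve G n) f"
proof -
  have "continuous_map X (product_topology (\<lambda>_. gtop G) {1..max 1 n}) f"
    using assms by (auto simp: continuous_map_componentwise nerve_iff)
  moreover have "f x \<in> {g. (\<forall>i. 1 \<le> i \<and> i < n \<longrightarrow> composable G (g i) (g (Suc i))) \<and> (n = 0 \<longrightarrow> g 1 \<in> gunits G)}"
    if "x \<in> topspace X" for x
    using assms(1)[OF that] by (simp add: nerve_iff)
  ultimately show ?thesis unfolding nerve_eq by (auto simp: continuous_map_in_subtopology)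
qed

lemma continuous_map_src_nerve:
  "j \<in> {1..max 1 n} \<Longrightarrow> continuous_map (nerve G n) (gtop G) (\<lambda>g. gsrc G (g j))"
  by (intro continuous_map_gsrc continuous_map_nerve_proj)

lemma continuous_map_rng_nerve:
  "j \<in> {1..max 1 n} \<Longrightarrow> continuous_map (nerve G n) (gtop G) (\<lambda>g. grng G (g j))"
  by (intro continuous_map_grng continuous_map_nerve_proj)

lemma vertex_in_gunits:
  assumes "g \<in> topspace (nerve G n)" "i \<le> n"
  shows "vertex G i g \<in> gunits G"
  using assms by (auto simp: vertex_def intro!: rng_in_gunits src_in_gunits nerve_garr)

lemma continuous_map_vertex:
  assumes "i \<le> n"
  shows "continuous_map (nerve G n) (unit_space G) (vertex G i)"
proof -
  have "continuous_map (nerve G n) (gtop G) (vertex G i)"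
    using assms continuous_map_src_nerve[of i n] continuous_map_rng_nerve[of 1 n]
    by (auto simp: vertex_def[abs_def])
  then show ?thesis using vertex_in_gunits[OF _ assms]
    by (auto simp: unit_space_def continuous_map_in_subtopology)
qed

lemma face_map_in_nerve:
  assumes g: "g \<in> topspace (nerve G (Suc n))" and i: "i \<le> Suc n"
  shows "face_map G n i g \<in> topspace (nerve G n)"
proof (cases "n = 0")
  case True
  have "g 1 \<in> garr G" using nerve_garr[OF g, of 1] by simp
  then show ?thesis
    using True by (auto simp: nerve_iff face_map_0 src_closed rng_closed src_in_gunits rng_in_gunits)
next
  case False
  have arr: "g j \<in> garr G" if "1 \<le> j" "j \<le> Suc n" for j using nerve_garr[OF g] that by simp
  have com: "composable G (g j) (g (Suc j))" if "1 \<le> j" "j \<le> n" for j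
    using nerve_composable[OF g] that by simp
  have src: "gsrc G (gmult G (g j) (g (Suc j))) = gsrc G (g (Suc j))"
    and rng: "grng G (gmult G (g j) (g (Suc j))) = grng G (g j)"
    and mul: "gmult G (g j) (g (Suc j)) \<in> garr G"
    and sr: "gsrc G (g j) = grng G (g (Suc j))" if "1 \<le> j" "j \<le> n" for j
    using com[OF that] src_mult rng_mult mult_closed by (auto simp: composable_def)
  have m: "max 1 n = n" using False by simp
  show ?thesis
    unfolding nerve_iff m
  proof (intro conjI allI impI ballI)
    show "face_map G n i g \<in> extensional {1..n}" using False by (simp add: face_map_pos)
    show A: "face_map G n i g j \<in> garr G" if "j \<in> {1..n}" for j
      using that i False mul arr by (auto simp: face_map_pos)
    fix j assume j: "1 \<le> j \<and> j < n"
    then have "face_map G n i g j \<in> garr G" "face_map G n i g (Suc j) \<in> garr G" using A by auto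
    moreover have "gsrc G (face_map G n i g j) = grng G (face_map G n i g (Suc j))"
    proof -
      consider "Suc j < i" | "Suc j = i" | "j = i" | "i < j" by linarith
      then show ?thesis
        by cases (use j False src rng sr in \<open>auto simp: face_map_pos\<close>)
    qed
    ultimately show "composable G (face_map G n i g j) (face_map G n i g (Suc j))"
      by (simp add: composable_def)
  qed (use False in auto)
qed

lemma continuous_map_face_map:
  assumes "i \<le> Suc n"
  shows "continuous_map (nerve G (Suc n)) (nerve G n) (face_map G n i)"
proof (rule continuous_map_into_nerve)
  fix j assume j: "j \<in> {1..max 1 n}"
  show "continuous_map (nerve G (Suc n)) (gtop G) (\<lambda>g. face_map G n i g j)"
  proof (cases "n = 0")
    case True
    then show ?thesis
      using j continuous_map_src_nerve[of 1 1] continuous_map_rng_nerve[of 1 1] by (auto simp: face_map_0)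
  next
    case False
    consider "j < i" | "j = i" | "i < j" by linarith
    then show ?thesis
    proof cases
      case 2
      have "continuous_map (nerve G (Suc n)) (gtop G) (\<lambda>g. gmult G (g i) (g (Suc i)))"
        using j 2 False by (intro continuous_map_gmult continuous_map_nerve_proj) (auto intro: nerve_composable)
      then show ?thesis using j 2 False by (simp add: face_map_pos)
    qed (use j False in \<open>auto simp: face_map_pos intro!: continuous_map_nerve_proj\<close>)
  qed
qed (use face_map_in_nerve assms in blast)

text \<open>For \<open>n > 0\<close> the two faces interact only if \<open>j = i + 1\<close> and both multiply, and then the identity is
  associativity. For \<open>n = 0\<close> the identities express the source and the range of a product and the
  composability of its factors.\<close>

lemma face_map_face_map:
  assumes g: "g \<in> topspace (nerve G (Suc (Suc n)))" and ij: "i < j" "j \<le> Suc (Suc n)"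
  shows "face_map G n i (face_map G (Suc n) j g) = face_map G n (j - 1) (face_map G (Suc n) i g)"
proof -
  have com: "composable G (g k) (g (Suc k))" if "1 \<le> k" "k \<le> Suc n" for k
    using nerve_composable[OF g] that by simp
  have assoc: "gmult G (gmult G (g k) (g (Suc k))) (g (Suc (Suc k))) = gmult G (g k) (gmult G (g (Suc k)) (g (Suc (Suc k))))"
    if "1 \<le> k" "k \<le> n" for k
    using mult_assoc[OF com[of k] com[of "Suc k"]] that by simp
  have src: "gsrc G (gmult G (g k) (g (Suc k))) = gsrc G (g (Suc k))"
    and rng: "grng G (gmult G (g k) (g (Suc k))) = grng G (g k)"
    and sr: "gsrc G (g k) = grng G (g (Suc k))" if "1 \<le> k" "k \<le> Suc n" for k
    using com[OF that] src_mult rng_mult by (auto simp: composable_def)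
  show ?thesis
  proof (cases "n = 0")
    case True
    then consider "i = 0" "j = 1" | "i = 0" "j = 2" | "i = 1" "j = 2" using ij by linarith
    then show ?thesis
      by cases (use True src[of 1] rng[of 1] sr[of 1] in
          \<open>auto simp: face_map_0 face_map_pos numeral_2_eq_2 intro!: restrict_ext\<close>)
  next
    case False
    show ?thesis
    proof
      fix k
      show "face_map G n i (face_map G (Suc n) j g) k = face_map G n (j - 1) (face_map G (Suc n) i g) k"
      proof (cases "k \<in> {1..n}")
        case k: True
        consider "k < i" | "k = i" "Suc i = j" | "k = i" "Suc i < j" | "i < k" "Suc k < j"
          | "i < k" "Suc k = j" | "j \<le> k" using ij by linarith
        then show ?thesis
          by cases (use k ij False assoc[of k] in \<open>auto simp: face_map_pos\<close>)
      next
        case k: False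
        have "0 < n" using False by simp
        show ?thesis unfolding face_map_pos[OF \<open>0 < n\<close>] using k by (simp only: restrict_apply if_False)
      qed
    qed
  qed
qed

end

section \<open>Etale maps between nerves\<close>

context Hausdorff_etale_groupoid
begin

lemma vertex_0_face_map_0:
  assumes g: "g \<in> topspace (nerve G (Suc n))"
  shows "vertex G 0 (face_map G n 0 g) = gsrc G (g 1)"
proof (cases "n = 0")
  case True
  have "g 1 \<in> garr G" using nerve_garr[OF g, of 1] by simp
  then show ?thesis using True by (simp add: vertex_def face_map_0 rng_src)
next
  case False
  have "composable G (g 1) (g (Suc 1))" using nerve_composable[OF g, of 1] False by simp
  then show ?thesis using False by (simp add: vertex_def face_map_pos composable_def)
qed

text \<open>Dropping \<open>g\<^sub>1\<close> is the pullback of the source map along the vertex \<open>r(g\<^sub>2)\<close>: since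
  \<open>s(g\<^sub>1) = r(g\<^sub>2)\<close>, a local inverse of the source map reconstructs \<open>g\<^sub>1\<close> from the remaining string.\<close>

lemma etale_map_face_map_0: "etale_map (nerve G (Suc n)) (nerve G n) (face_map G n 0)"
proof (rule etale_mapI_local_sections)
  show c: "continuous_map (nerve G (Suc n)) (nerve G n) (face_map G n 0)"
    by (rule continuous_map_face_map) simp
  fix g assume g: "g \<in> topspace (nerve G (Suc n))"
  have g1: "g 1 \<in> topspace (gtop G)" using nerve_garr[OF g, of 1] by (simp add: garr_def)
  obtain U where U: "openin (gtop G) U" "g 1 \<in> U" "inj_on (gsrc G) U"
    using etale_mapD(3)[OF etale_src g1] by blast
  have UG: "U \<subseteq> garr G" using openin_subset[OF U(1)] by (simp add: garr_def)
  \<comment> \<open>\<open>e\<close> prefixes a string with the arrow of \<open>U\<close> whose source is the first vertex of the string.\<close>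
  let ?\<tau> = "inv_into U (gsrc G)"
  let ?U = "{h \<in> topspace (nerve G (Suc n)). h 1 \<in> U}"
  let ?V = "{h \<in> topspace (nerve G n). vertex G 0 h \<in> gsrc G ` U}"
  define e where "e h = (\<lambda>j\<in>{1..Suc n}. if j = 1 then ?\<tau> (vertex G 0 h) else h (j - 1))" for h
  have \<tau>: "?\<tau> v \<in> U" "gsrc G (?\<tau> v) = v" if "v \<in> gsrc G ` U" for v
    using that by (auto intro: inv_into_into f_inv_into_f)
  have U_open: "openin (nerve G (Suc n)) ?U"
    by (rule openin_continuous_map_preimage[OF continuous_map_nerve_proj U(1)]) simp
  have U_inj: "inj_on (face_map G n 0) ?U"
  proof (rule inj_onI)
    fix h k assume h: "h \<in> ?U" and k: "k \<in> ?U" and eq: "face_map G n 0 h = face_map G n 0 k"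
    have "gsrc G (h 1) = gsrc G (k 1)"
      using vertex_0_face_map_0[of h n] vertex_0_face_map_0[of k n] h k eq by simp
    then have 1: "h 1 = k 1" using U(3) h k by (auto simp: inj_on_def)
    show "h = k"
    proof (rule extensionalityI[where A = "{1..Suc n}"])
      fix j assume j: "j \<in> {1..Suc n}"
      show "h j = k j"
      proof (cases "j = 1")
        case False
        then have "n > 0" "j - 1 \<in> {1..n}" "Suc (j - 1) = j" using j by auto
        then show ?thesis using fun_cong[OF eq, of "j - 1"] by (simp add: face_map_pos)
      qed (use 1 in simp)
    qed (use h k in \<open>auto simp: nerve_iff\<close>)
  qed
  have V_open: "openin (nerve G n) ?V"
    using etale_mapD(2)[OF etale_src] U(1)
    by (intro openin_continuous_map_preimage[OF continuous_map_vertex]) (auto simp: open_map_def)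
  have in_V: "face_map G n 0 g \<in> ?V"
    using vertex_0_face_map_0[OF g] U(2) face_map_in_nerve[OF g] by auto
  have e_cont: "continuous_map (subtopology (nerve G n) ?V) (nerve G (Suc n)) e"
  proof (rule continuous_map_into_nerve)
    fix h assume "h \<in> topspace (subtopology (nerve G n) ?V)"
    then have h: "h \<in> topspace (nerve G n)" and v: "vertex G 0 h \<in> gsrc G ` U" by auto
    show "e h \<in> topspace (nerve G (Suc n))"
      unfolding nerve_iff
    proof (intro conjI allI impI ballI)
      show "e h \<in> extensional {1..max 1 (Suc n)}" by (simp add: e_def)
      have arr: "?\<tau> (vertex G 0 h) \<in> garr G" using \<tau>[OF v] UG by blast
      show A: "e h j \<in> garr G" if "j \<in> {1..max 1 (Suc n)}" for j
        using that arr nerve_garr[OF h, of "j - 1"] by (auto simp: e_def)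
      fix i assume i: "1 \<le> i \<and> i < Suc n"
      have "e h i \<in> garr G" "e h (Suc i) \<in> garr G" using A i by auto
      moreover have "gsrc G (e h i) = grng G (e h (Suc i))"
      proof (cases "i = 1")
        case True
        then show ?thesis using i \<tau>[OF v] by (simp add: e_def vertex_def)
      next
        case False
        then obtain k where k: "i = Suc k" "1 \<le> k" using i by (cases i) auto
        then have "composable G (h k) (h (Suc k))" using nerve_composable[OF h, of k] i by simp
        then show ?thesis using k i by (simp add: e_def composable_def)
      qed
      ultimately show "composable G (e h i) (e h (Suc i))" by (simp add: composable_def)
    qed simp
  next
    fix j assume j: "j \<in> {1..max 1 (Suc n)}"
    show "continuous_map (subtopology (nerve G n) ?V) (gtop G) (\<lambda>h. e h j)"
    proof (cases "j = 1")
      case True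
      have "continuous_map (subtopology (nerve G n) ?V) (subtopology (unit_space G) (gsrc G ` U)) (vertex G 0)"
        using continuous_map_vertex[of 0 n]
        by (auto simp: continuous_map_in_subtopology intro: continuous_map_from_subtopology)
      from continuous_map_compose[OF this etale_map_local_inverse[OF etale_src U(1,3)]]
      show ?thesis using True by (simp add: e_def o_def)
    next
      case False
      have "continuous_map (nerve G n) (gtop G) (\<lambda>h. h (j - 1))"
        using j False by (intro continuous_map_nerve_proj) auto
      then show ?thesis using j False by (auto simp: e_def intro: continuous_map_from_subtopology)
    qed
  qed
  have e_g: "e (face_map G n 0 g) = g"
  proof (rule extensionalityI[where A = "{1..Suc n}"])
    fix j assume j: "j \<in> {1..Suc n}"
    show "e (face_map G n 0 g) j = g j"
      using j vertex_0_face_map_0[OF g] inv_into_f_f[OF U(3,2)] by (auto simp: e_def face_map_pos)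
  qed (use g in \<open>auto simp: nerve_iff e_def\<close>)
  have e_section: "face_map G n 0 (e h) = h" if "h \<in> ?V" for h
  proof (rule extensionalityI[where A = "{1..max 1 n}"])
    have h: "h \<in> topspace (nerve G n)" and v: "vertex G 0 h \<in> gsrc G ` U" using that by auto
    show "h \<in> extensional {1..max 1 n}" using h by (simp add: nerve_iff)
    show "face_map G n 0 (e h) \<in> extensional {1..max 1 n}" by (cases "n = 0") (auto simp: face_map_0 face_map_pos)
    fix j assume j: "j \<in> {1..max 1 n}"
    show "face_map G n 0 (e h) j = h j"
    proof (cases "n = 0")
      case True
      then have "h 1 \<in> gunits G" "j = 1" using h j by (auto simp: nerve_iff)
      then show ?thesis using True \<tau>[OF v] by (simp add: face_map_0 e_def vertex_def rng_unit)
    next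
      case False
      then show ?thesis using j by (simp add: face_map_pos e_def)
    qed
  qed
  have in_U: "g \<in> ?U" using g U(2) by simp
  show "\<exists>U V e. openin (nerve G (Suc n)) U \<and> g \<in> U \<and> inj_on (face_map G n 0) U \<and>
      openin (nerve G n) V \<and> face_map G n 0 g \<in> V \<and> continuous_map (subtopology (nerve G n) V) (nerve G (Suc n)) e \<and>
      e (face_map G n 0 g) = g \<and> (\<forall>y\<in>V. face_map G n 0 (e y) = y)"
    by (intro exI[of _ ?U] exI[of _ ?V] exI[of _ e] conjI ballI)
      (rule U_open in_U U_inj V_open in_V e_cont e_g e_section | assumption)+
qed

text \<open>The projection to the last vertex is a composite of faces with index \<open>0\<close>.\<close>

lemma etale_map_last_vertex: "etale_map (nerve G n) (nerve G 0) (last_vertex G n)"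
proof (induction n)
  case 0
  show ?case
    by (rule etale_map_cong[OF etale_map_id])
      (auto simp: last_vertex_def nerve_iff fun_eq_iff extensional_def)
next
  case (Suc n)
  show ?case
    by (rule etale_map_cong[OF etale_map_compose[OF etale_map_face_map_0 Suc.IH]])
      (auto simp: last_vertex_def face_map_0 face_map_pos intro!: restrict_ext)
qed

lemma etale_map_into_nerve:
  assumes "continuous_map X (nerve G m) f" and "etale_map X (nerve G 0) (\<lambda>x. last_vertex G m (f x))"
  shows "etale_map X (nerve G m) f"
  using etale_map_cancel[OF assms(2) etale_map_last_vertex assms(1)] .

lemma etale_map_between_nerves:
  assumes "continuous_map (nerve G n) (nerve G m) f"
    and "\<And>g. g \<in> topspace (nerve G n) \<Longrightarrow> last_vertex G m (f g) = last_vertex G n g"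
  shows "etale_map (nerve G n) (nerve G m) f"
  by (rule etale_map_into_nerve[OF assms(1) etale_map_cong[OF etale_map_last_vertex[of n]]]) (simp add: assms(2))

text \<open>All faces except the last one keep the last vertex. The last face moves it to \<open>r(g)\<close> for the
  last entry \<open>g\<close>, and \<open>r\<close> is the source map after inversion.\<close>

lemma etale_map_face_map:
  assumes i: "i \<le> Suc n"
  shows "etale_map (nerve G (Suc n)) (nerve G n) (face_map G n i)"
proof (cases "i = Suc n")
  case False
  show ?thesis
  proof (rule etale_map_between_nerves[OF continuous_map_face_map[OF i]])
    fix g assume g: "g \<in> topspace (nerve G (Suc n))"
    have "n > 0 \<Longrightarrow> composable G (g n) (g (Suc n))" using nerve_composable[OF g, of n] by simp
    then show "last_vertex G n (face_map G n i g) = last_vertex G (Suc n) g"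
      using i False src_mult by (cases "n = 0") (auto simp: last_vertex_def face_map_0 face_map_pos intro!: restrict_ext)
  qed
next
  case True
  have c1: "continuous_map (nerve G (Suc n)) (nerve G 1) (\<lambda>g. \<lambda>j\<in>{1}. g (Suc n))"
    by (rule continuous_map_into_nerve) (auto simp: nerve_iff intro!: continuous_map_nerve_proj)
  have e1: "etale_map (nerve G (Suc n)) (nerve G 1) (\<lambda>g. \<lambda>j\<in>{1}. g (Suc n))"
    by (rule etale_map_between_nerves[OF c1]) (simp add: last_vertex_def)
  have c2: "continuous_map (nerve G 1) (nerve G 1) (\<lambda>g. \<lambda>j\<in>{1}. ginv G (g 1))"
    by (rule continuous_map_into_nerve) (auto simp: nerve_iff inv_closed intro!: continuous_map_ginv continuous_map_nerve_proj)
  have e2: "etale_map (nerve G 1) (nerve G 1) (\<lambda>g. \<lambda>j\<in>{1}. ginv G (g 1))"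
    by (rule etale_map_involution[OF c2]) (auto simp: nerve_iff inv_inv fun_eq_iff extensional_def)
  have e: "etale_map (nerve G (Suc n)) (nerve G 0) (\<lambda>g. last_vertex G 1 (\<lambda>j\<in>{1}. ginv G ((\<lambda>j\<in>{1}. g (Suc n)) 1)))"
    using etale_map_compose[OF etale_map_compose[OF e1 e2] etale_map_last_vertex] by simp
  show ?thesis
  proof (rule etale_map_into_nerve[OF continuous_map_face_map[OF i]], rule etale_map_cong[OF e])
    fix g assume g: "g \<in> topspace (nerve G (Suc n))"
    have "n > 0 \<Longrightarrow> composable G (g n) (g (Suc n))" using nerve_composable[OF g, of n] by simp
    moreover have "g (Suc n) \<in> garr G" using nerve_garr[OF g, of "Suc n"] by simp
    ultimately show "last_vertex G 1 (\<lambda>j\<in>{1}. ginv G ((\<lambda>j\<in>{1}. g (Suc n)) 1)) = last_vertex G n (face_map G n i g)"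
      using True by (cases "n = 0") (auto simp: last_vertex_def face_map_0 face_map_pos src_inv composable_def intro!: restrict_ext)
  qed
qed

end

section \<open>The chain complex\<close>

context Hausdorff_etale_groupoid
begin

lemma boundary_in_Cc:
  assumes "f \<in> Cc (nerve G (Suc n))"
  shows "boundary G (Suc n) f \<in> Cc (nerve G n)"
  unfolding boundary_eq[abs_def]
  by (intro Cc_sum pushforward_in_Cc etale_map_face_map Hausdorff_nerve assms) auto

lemma boundary_add:
  assumes "f \<in> Cc (nerve G n)" "g \<in> Cc (nerve G n)"
  shows "boundary G n (\<lambda>x. f x + g x) = (\<lambda>x. boundary G n f x + boundary G n g x)"
proof (cases n)
  case 0
  then show ?thesis by (simp add: boundary_def)
next
  case (Suc m)
  have "pushforward (nerve G (Suc m)) (face_map G m i) (\<lambda>x. f x + g x) y =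
      pushforward (nerve G (Suc m)) (face_map G m i) f y + pushforward (nerve G (Suc m)) (face_map G m i) g y"
    if "i \<le> Suc m" for i y
    using pushforward_add[OF etale_map_face_map[OF that]] assms Suc by simp
  then show ?thesis unfolding Suc boundary_eq[abs_def]
    by (simp add: distrib_left sum.distrib)
qed

lemma boundary_boundary:
  assumes f: "f \<in> Cc (nerve G (Suc n))"
  shows "boundary G n (boundary G (Suc n) f) = (\<lambda>x. 0)"
proof (cases n)
  case 0
  then show ?thesis by (simp add: boundary_def)
next
  case (Suc m)
  show ?thesis
  proof
    fix y
    let ?N = "nerve G (Suc (Suc m))"
    have f': "f \<in> Cc ?N" using f Suc by simp
    have "boundary G n (boundary G (Suc n) f) y =
       (\<Sum>i\<le>Suc m. (- 1) ^ i * (\<Sum>j\<le>Suc (Suc m). (- 1) ^ j *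
          pushforward (nerve G (Suc m)) (face_map G m i) (pushforward ?N (face_map G (Suc m) j) f) y))"
      unfolding Suc boundary_eq[abs_def]
      by (intro sum.cong refl arg_cong2[where f = "(*)"] pushforward_sum[OF etale_map_face_map]
          pushforward_in_Cc[OF etale_map_face_map] Hausdorff_nerve f') auto
    also have "\<dots> = (\<Sum>i\<le>Suc m. \<Sum>j\<le>Suc (Suc m). (- 1) ^ i * ((- 1) ^ j *
          pushforward ?N (\<lambda>g. face_map G m i (face_map G (Suc m) j g)) f y))"
      by (simp only: sum_distrib_left, intro sum.cong refl, subst pushforward_compose[OF etale_map_face_map etale_map_face_map f']) auto
    also have "\<dots> = 0"
    proof (rule alternating_double_sum_cancels)
      fix i j assume ij: "i < j" "j \<le> Suc (Suc m)"
      show "pushforward ?N (\<lambda>g. face_map G m i (face_map G (Suc m) j g)) f y =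
          pushforward ?N (\<lambda>g. face_map G m (j - 1) (face_map G (Suc m) i g)) f y"
        by (rule fun_cong[OF pushforward_cong]) (rule face_map_face_map[OF _ ij])
    qed
    finally show "boundary G n (boundary G (Suc n) f) y = 0" .
  qed
qed

lemma boundary_zero: "boundary G n (\<lambda>x. 0) = (\<lambda>x. 0)"
  using boundary_add[OF Cc_zero Cc_zero, of n] by (auto simp: fun_eq_iff)

lemma boundary_uminus:
  assumes f: "f \<in> Cc (nerve G n)"
  shows "boundary G n (\<lambda>x. - f x) = (\<lambda>x. - boundary G n f x)"
proof
  fix x
  show "boundary G n (\<lambda>x. - f x) x = - boundary G n f x"
    using fun_cong[OF boundary_add[OF f Cc_uminus[OF f]], of x] by (simp add: boundary_zero)
qed

lemma subgroup_cycles: "subgroup (cycles G n) (Cc_group (nerve G n))"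
  by (rule Cc_subgroupI)
    (auto simp: cycles_def Cc_zero boundary_zero boundary_add boundary_uminus Cc_add Cc_uminus)

lemma subgroup_boundaries: "subgroup (boundaries G n) (Cc_group (nerve G n))"
proof (rule Cc_subgroupI)
  show "boundaries G n \<subseteq> Cc (nerve G n)" by (auto simp: boundaries_def boundary_in_Cc)
  show "(\<lambda>x. 0) \<in> boundaries G n"
    unfolding boundaries_def by (rule image_eqI[where x = "\<lambda>x. 0"]) (simp_all add: boundary_zero Cc_zero)
  fix f assume "f \<in> boundaries G n"
  then obtain f' where f': "f = boundary G (Suc n) f'" "f' \<in> Cc (nerve G (Suc n))"
    by (auto simp: boundaries_def)
  show "(\<lambda>x. - f x) \<in> boundaries G n"
    unfolding boundaries_def f'(1) by (rule image_eqI[where x = "\<lambda>x. - f' x"]) (simp_all add: boundary_uminus Cc_uminus f'(2))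
  fix g assume "g \<in> boundaries G n"
  then obtain g' where g': "g = boundary G (Suc n) g'" "g' \<in> Cc (nerve G (Suc n))"
    by (auto simp: boundaries_def)
  show "(\<lambda>x. f x + g x) \<in> boundaries G n"
    unfolding boundaries_def f'(1) g'(1)
    by (rule image_eqI[where x = "\<lambda>x. f' x + g' x"]) (simp_all add: boundary_add Cc_add f'(2) g'(2))
qed

lemma boundaries_subset_cycles: "boundaries G n \<subseteq> cycles G n"
  by (auto simp: boundaries_def cycles_def boundary_in_Cc boundary_boundary)

end

section \<open>Chain maps induced by homomorphisms\<close>

definition nerve_map :: "('a \<Rightarrow> 'b) \<Rightarrow> nat \<Rightarrow> (nat \<Rightarrow> 'a) \<Rightarrow> nat \<Rightarrow> 'b"
  where "nerve_map \<phi> n g = (\<lambda>j\<in>{1..max 1 n}. \<phi> (g j))"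

locale groupoid_hom = K: Hausdorff_etale_groupoid K + L: Hausdorff_etale_groupoid L
  for K :: "'a top_groupoid" and L :: "'b top_groupoid" +
  fixes \<phi> :: "'a \<Rightarrow> 'b"
  assumes hom_continuous: "continuous_map (gtop K) (gtop L) \<phi>"
    and hom_mult: "composable K g h \<Longrightarrow> \<phi> (gmult K g h) = gmult L (\<phi> g) (\<phi> h)"
    and hom_src: "g \<in> garr K \<Longrightarrow> gsrc L (\<phi> g) = \<phi> (gsrc K g)"
    and hom_rng: "g \<in> garr K \<Longrightarrow> grng L (\<phi> g) = \<phi> (grng K g)"
begin

lemma hom_closed: "g \<in> garr K \<Longrightarrow> \<phi> g \<in> garr L"
  using hom_continuous by (auto simp: continuous_map_def garr_def)

lemma hom_composable: "composable K g h \<Longrightarrow> composable L (\<phi> g) (\<phi> h)"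
  by (simp add: composable_def hom_closed hom_src hom_rng)

lemma hom_unit: "u \<in> gunits K \<Longrightarrow> \<phi> u \<in> gunits L"
  by (simp add: K.gunits_iff L.gunits_iff hom_closed hom_src)

lemma nerve_map_in_nerve: "g \<in> topspace (nerve K n) \<Longrightarrow> nerve_map \<phi> n g \<in> topspace (nerve L n)"
  by (auto simp: K.nerve_iff L.nerve_iff nerve_map_def hom_closed hom_unit intro!: hom_composable)

lemma continuous_map_nerve_map: "continuous_map (nerve K n) (nerve L n) (nerve_map \<phi> n)"
proof (rule L.continuous_map_into_nerve)
  fix j assume "j \<in> {1..max 1 n}"
  then show "continuous_map (nerve K n) (gtop L) (\<lambda>g. nerve_map \<phi> n g j)"
    using continuous_map_compose[OF K.continuous_map_nerve_proj hom_continuous]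
    by (simp add: nerve_map_def o_def)
qed (rule nerve_map_in_nerve)

lemma face_map_nerve_map:
  assumes g: "g \<in> topspace (nerve K (Suc n))" and i: "i \<le> Suc n"
  shows "face_map L n i (nerve_map \<phi> (Suc n) g) = nerve_map \<phi> n (face_map K n i g)"
proof (cases "n = 0")
  case True
  then show ?thesis using K.nerve_garr[OF g, of 1]
    by (auto simp: face_map_0 nerve_map_def hom_src hom_rng intro!: restrict_ext)
next
  case False
  have "\<phi> (gmult K (g j) (g (Suc j))) = gmult L (\<phi> (g j)) (\<phi> (g (Suc j)))" if "1 \<le> j" "j \<le> n" for j
    using hom_mult[OF K.nerve_composable[OF g, of j]] that by simp
  then show ?thesis using False i by (auto simp: face_map_pos nerve_map_def intro!: restrict_ext)
qed

lemma last_vertex_nerve_map: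
  assumes g: "g \<in> topspace (nerve K n)"
  shows "last_vertex L n (nerve_map \<phi> n g) = nerve_map \<phi> 0 (last_vertex K n g)"
  using K.nerve_garr[OF g, of n] by (auto simp: last_vertex_def nerve_map_def hom_src intro!: restrict_ext)

end

text \<open>It is enough to ask for an etale map on units: on the nerves it follows by cancelling the last
  vertex.\<close>

locale etale_hom = groupoid_hom +
  assumes etale_units: "etale_map (nerve K 0) (nerve L 0) (nerve_map \<phi> 0)"
begin

lemma etale_map_nerve_map: "etale_map (nerve K n) (nerve L n) (nerve_map \<phi> n)"
  by (rule L.etale_map_into_nerve[OF continuous_map_nerve_map
      etale_map_cong[OF etale_map_compose[OF K.etale_map_last_vertex etale_units]]])
    (simp add: last_vertex_nerve_map)

definition chain_map :: "nat \<Rightarrow> ((nat \<Rightarrow> 'a) \<Rightarrow> int) \<Rightarrow> (nat \<Rightarrow> 'b) \<Rightarrow> int"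
  where "chain_map n = pushforward (nerve K n) (nerve_map \<phi> n)"

lemma chain_in_Cc: "f \<in> Cc (nerve K n) \<Longrightarrow> chain_map n f \<in> Cc (nerve L n)"
  unfolding chain_map_def by (intro pushforward_in_Cc etale_map_nerve_map K.Hausdorff_nerve L.Hausdorff_nerve)

lemma chain_add:
  assumes "f \<in> Cc (nerve K n)" "g \<in> Cc (nerve K n)"
  shows "chain_map n (\<lambda>x. f x + g x) = (\<lambda>x. chain_map n f x + chain_map n g x)"
  unfolding chain_map_def using pushforward_add[OF etale_map_nerve_map assms] by blast

lemma chain_zero: "chain_map n (\<lambda>x. 0) = (\<lambda>x. 0)"
  using chain_add[OF Cc_zero Cc_zero, of n] by (auto simp: fun_eq_iff)

text \<open>Both sides are alternating sums of pushforwards along the same maps, since a homomorphism commutes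
  with faces.\<close>

lemma boundary_chain:
  assumes f: "f \<in> Cc (nerve K (Suc n))"
  shows "boundary L (Suc n) (chain_map (Suc n) f) = chain_map n (boundary K (Suc n) f)"
proof
  fix y
  have "boundary L (Suc n) (chain_map (Suc n) f) y =
      (\<Sum>i\<le>Suc n. (- 1) ^ i * pushforward (nerve K (Suc n)) (\<lambda>g. face_map L n i (nerve_map \<phi> (Suc n) g)) f y)"
    unfolding boundary_eq chain_map_def
    by (intro sum.cong refl, subst pushforward_compose[OF etale_map_nerve_map L.etale_map_face_map f]) auto
  also have "\<dots> = (\<Sum>i\<le>Suc n. (- 1) ^ i * pushforward (nerve K (Suc n)) (\<lambda>g. nerve_map \<phi> n (face_map K n i g)) f y)"
    by (intro sum.cong refl arg_cong2[where f = "(*)"] fun_cong[OF pushforward_cong]) (simp add: face_map_nerve_map)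
  also have "\<dots> = (\<Sum>i\<le>Suc n. (- 1) ^ i * chain_map n (pushforward (nerve K (Suc n)) (face_map K n i) f) y)"
    unfolding chain_map_def
    by (intro sum.cong refl, subst pushforward_compose[OF K.etale_map_face_map etale_map_nerve_map f]) auto
  also have "\<dots> = chain_map n (boundary K (Suc n) f) y"
    unfolding boundary_eq[abs_def] chain_map_def
    by (subst pushforward_sum[OF etale_map_nerve_map])
      (auto intro!: pushforward_in_Cc[OF K.etale_map_face_map] K.Hausdorff_nerve f)
  finally show "boundary L (Suc n) (chain_map (Suc n) f) y = chain_map n (boundary K (Suc n) f) y" .
qed

lemma chain_cycles: "f \<in> cycles K n \<Longrightarrow> chain_map n f \<in> cycles L n"
proof (cases n)
  case (Suc m)
  assume "f \<in> cycles K n"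
  then show ?thesis using boundary_chain[of f m] Suc
    by (simp add: cycles_def chain_in_Cc chain_zero del: One_nat_def)
qed (auto simp: cycles_def chain_in_Cc boundary_def)

lemma chain_boundaries: "f \<in> boundaries K n \<Longrightarrow> chain_map n f \<in> boundaries L n"
  unfolding boundaries_def by (auto simp: boundary_chain[symmetric] chain_in_Cc)

end

section \<open>Chain homotopies from natural transformations\<close>

text \<open>The \<open>i\<close>-th simplex in the usual triangulation of the prism between a string and its image under
  \<open>\<phi>\<close>: it takes the first \<open>i\<close> entries from the image, crosses over by \<open>\<theta>\<close> at the \<open>i\<close>-th vertex, and
  continues in the original string.\<close>

definition prism :: "'a top_groupoid \<Rightarrow> ('a \<Rightarrow> 'a) \<Rightarrow> ('a \<Rightarrow> 'a) \<Rightarrow> nat \<Rightarrow> nat \<Rightarrow> (nat \<Rightarrow> 'a) \<Rightarrow> nat \<Rightarrow> 'a"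
  where "prism K \<phi> \<theta> n i g = (\<lambda>j\<in>{1..Suc n}.
     if j \<le> i then \<phi> (g j) else if j = Suc i then \<theta> (vertex K i g) else g (j - 1))"

locale natural_transformation_from_id = groupoid_hom K K \<phi>
  for K :: "'a top_groupoid" and \<phi> +
  fixes \<theta> :: "'a \<Rightarrow> 'a"
  assumes trans_continuous: "continuous_map (unit_space K) (gtop K) \<theta>"
    and trans_src: "u \<in> gunits K \<Longrightarrow> gsrc K (\<theta> u) = u"
    and trans_rng: "u \<in> gunits K \<Longrightarrow> grng K (\<theta> u) = \<phi> u"
    and trans_natural: "g \<in> garr K \<Longrightarrow>
          gmult K (\<phi> g) (\<theta> (gsrc K g)) = gmult K (\<theta> (grng K g)) g"
begin

lemma trans_closed: "u \<in> gunits K \<Longrightarrow> \<theta> u \<in> garr K"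
  using trans_continuous by (auto simp: continuous_map_def garr_def K.topspace_unit_space)

lemma prism_in_nerve:
  assumes g: "g \<in> topspace (nerve K n)" and i: "i \<le> n"
  shows "prism K \<phi> \<theta> n i g \<in> topspace (nerve K (Suc n))"
  unfolding K.nerve_iff
proof (intro conjI allI impI ballI)
  let ?p = "prism K \<phi> \<theta> n i g"
  show "?p \<in> extensional {1..max 1 (Suc n)}" by (simp add: prism_def)
  have v: "vertex K i g \<in> gunits K" by (rule K.vertex_in_gunits[OF g i])
  have arr: "g j \<in> garr K" if "1 \<le> j" "j \<le> max 1 n" for j using K.nerve_garr[OF g] that by simp
  have com: "gsrc K (g j) = grng K (g (Suc j))" if "1 \<le> j" "j < n" for j
    using K.nerve_composable[OF g that] by (simp add: composable_def)
  show A: "?p j \<in> garr K" if j: "j \<in> {1..max 1 (Suc n)}" for j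
  proof -
    consider "j \<le> i" | "j = Suc i" | k where "j = Suc k" "i < k" by (cases j) force+
    then show ?thesis
      by cases (use i j arr trans_closed[OF v] in \<open>auto simp: prism_def hom_closed\<close>)
  qed
  fix j assume j: "1 \<le> j \<and> j < Suc n"
  then have "?p j \<in> garr K" "?p (Suc j) \<in> garr K" using A by auto
  moreover have "gsrc K (?p j) = grng K (?p (Suc j))"
  proof -
    consider "Suc j \<le> i" | "j = i" | "j = Suc i" | k where "j = Suc k" "i < k"
      by (cases j) force+
    then show ?thesis
    proof cases
      case 1
      then show ?thesis using i j com[of j] arr by (simp add: prism_def hom_src hom_rng)
    next
      case 2
      then show ?thesis using i j arr v trans_rng[OF v] by (simp add: prism_def hom_src vertex_def)
    next
      case 3
      then show ?thesis using i j trans_src[OF v] com[of i] by (auto simp: prism_def vertex_def)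
    next
      case 4
      then show ?thesis using i j com[of k] by (simp add: prism_def)
    qed
  qed
  ultimately show "composable K (?p j) (?p (Suc j))" by (simp add: composable_def)
qed simp

lemma continuous_map_prism:
  assumes i: "i \<le> n"
  shows "continuous_map (nerve K n) (nerve K (Suc n)) (prism K \<phi> \<theta> n i)"
proof (rule K.continuous_map_into_nerve)
  fix j assume j: "j \<in> {1..max 1 (Suc n)}"
  consider "j \<le> i" | "j = Suc i" | "Suc i < j" by linarith
  then show "continuous_map (nerve K n) (gtop K) (\<lambda>g. prism K \<phi> \<theta> n i g j)"
  proof cases
    case 1
    then have "continuous_map (nerve K n) (gtop K) (\<lambda>g. \<phi> (g j))"
      using continuous_map_compose[OF K.continuous_map_nerve_proj hom_continuous, of j n] i j by (simp add: o_def)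
    then show ?thesis using 1 i j by (simp add: prism_def)
  next
    case 2
    then show ?thesis
      using continuous_map_compose[OF K.continuous_map_vertex[OF i] trans_continuous] i by (simp add: prism_def o_def)
  next
    case 3
    then have "continuous_map (nerve K n) (gtop K) (\<lambda>g. g (j - 1))"
      using j by (intro K.continuous_map_nerve_proj) auto
    then show ?thesis using 3 j by (simp add: prism_def)
  qed
qed (rule prism_in_nerve[OF _ i])

text \<open>The last vertex survives: in \<open>prism K \<phi> \<theta> n n g\<close> the last entry is \<open>\<theta>(v\<^sub>n)\<close>, with source \<open>v\<^sub>n\<close>, and in
  the other prisms it is the last entry of \<open>g\<close>.\<close>

lemma etale_map_prism:
  assumes i: "i \<le> n"
  shows "etale_map (nerve K n) (nerve K (Suc n)) (prism K \<phi> \<theta> n i)"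
proof (rule K.etale_map_between_nerves[OF continuous_map_prism[OF i]])
  fix g assume g: "g \<in> topspace (nerve K n)"
  have "gsrc K (\<theta> (vertex K i g)) = vertex K i g"
    by (rule trans_src[OF K.vertex_in_gunits[OF g i]])
  moreover have "n = 0 \<Longrightarrow> grng K (g 1) = g 1"
    using g K.rng_unit by (simp add: K.nerve_iff)
  ultimately show "last_vertex K (Suc n) (prism K \<phi> \<theta> n i g) = last_vertex K n g"
    using i by (auto simp: last_vertex_def prism_def vertex_def intro!: restrict_ext)
qed

lemma face_map_prism_first:
  assumes g: "g \<in> topspace (nerve K n)"
  shows "face_map K n 0 (prism K \<phi> \<theta> n 0 g) = g"
proof (rule extensionalityI[where A = "{1..max 1 n}"])
  show "face_map K n 0 (prism K \<phi> \<theta> n 0 g) \<in> extensional {1..max 1 n}"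
    by (cases "n = 0") (auto simp: face_map_0 face_map_pos)
  show "g \<in> extensional {1..max 1 n}" using g by (simp add: K.nerve_iff)
  fix j assume j: "j \<in> {1..max 1 n}"
  show "face_map K n 0 (prism K \<phi> \<theta> n 0 g) j = g j"
  proof (cases "n = 0")
    case True
    have "gsrc K (\<theta> (vertex K 0 g)) = vertex K 0 g"
      by (rule trans_src[OF K.vertex_in_gunits[OF g]]) simp
    moreover have "grng K (g 1) = g 1" using g True K.rng_unit by (simp add: K.nerve_iff)
    ultimately show ?thesis using True j by (simp add: face_map_0 prism_def vertex_def)
  qed (use j in \<open>simp add: face_map_pos prism_def\<close>)
qed

lemma face_map_prism_last:
  assumes g: "g \<in> topspace (nerve K n)"
  shows "face_map K n (Suc n) (prism K \<phi> \<theta> n n g) = nerve_map \<phi> n g"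
proof (cases "n = 0")
  case True
  have "grng K (\<theta> (vertex K 0 g)) = \<phi> (vertex K 0 g)"
    by (rule trans_rng[OF K.vertex_in_gunits[OF g]]) simp
  moreover have "grng K (g 1) = g 1" using g True K.rng_unit by (simp add: K.nerve_iff)
  ultimately show ?thesis using True
    by (auto simp: face_map_0 prism_def vertex_def nerve_map_def intro!: restrict_ext)
next
  case False
  then show ?thesis by (auto simp: face_map_pos prism_def nerve_map_def intro!: restrict_ext)
qed

text \<open>The only identity that needs naturality: the two sides have \<open>\<phi>(g\<^sub>j\<^sub>+\<^sub>1)\<theta>(v\<^sub>j\<^sub>+\<^sub>1)\<close> and
  \<open>\<theta>(v\<^sub>j)g\<^sub>j\<^sub>+\<^sub>1\<close> as entry \<open>j + 1\<close>.\<close>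

lemma face_map_prism_middle:
  assumes g: "g \<in> topspace (nerve K n)" and j: "j < n"
  shows "face_map K n (Suc j) (prism K \<phi> \<theta> n (Suc j) g) = face_map K n (Suc j) (prism K \<phi> \<theta> n j g)"
proof -
  have "g (Suc j) \<in> garr K" using K.nerve_garr[OF g, of "Suc j"] j by simp
  moreover have "vertex K j g = grng K (g (Suc j))"
    using K.nerve_composable[OF g, of j] j by (auto simp: vertex_def composable_def)
  ultimately have "gmult K (\<phi> (g (Suc j))) (\<theta> (vertex K (Suc j) g)) = gmult K (\<theta> (vertex K j g)) (g (Suc j))"
    using trans_natural by (simp add: vertex_def)
  then show ?thesis using j by (auto simp: face_map_pos prism_def intro!: restrict_ext)
qed

lemma vertex_face_map_below:
  assumes g: "g \<in> topspace (nerve K (Suc m))" and ij: "i \<le> j" "j \<le> m"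
  shows "vertex K j (face_map K m i g) = vertex K (Suc j) g"
proof (cases "m = 0")
  case True
  then show ?thesis using ij K.nerve_garr[OF g, of 1] by (simp add: vertex_def face_map_0 K.rng_src)
next
  case False
  have com: "composable K (g k) (g (Suc k))" if "1 \<le> k" "k \<le> m" for k
    using K.nerve_composable[OF g, of k] that by simp
  show ?thesis
  proof (cases "j = 0")
    case True
    then show ?thesis using False ij com[of 1] by (simp add: vertex_def face_map_pos composable_def)
  next
    case j: False
    then show ?thesis using False ij K.src_mult[OF com[of j]] by (auto simp: vertex_def face_map_pos)
  qed
qed

lemma vertex_face_map_above:
  assumes g: "g \<in> topspace (nerve K (Suc m))" and ij: "j < i" "i \<le> Suc m"
  shows "vertex K j (face_map K m i g) = vertex K j g"
proof (cases "m = 0")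
  case True
  then show ?thesis using ij K.nerve_garr[OF g, of 1] by (simp add: vertex_def face_map_0 K.rng_rng)
next
  case False
  have com: "composable K (g k) (g (Suc k))" if "1 \<le> k" "k \<le> m" for k
    using K.nerve_composable[OF g, of k] that by simp
  then show ?thesis using False ij K.rng_mult[OF com[of 1]]
    by (cases "i = 1") (auto simp: vertex_def face_map_pos)
qed

lemma face_map_prism_below:
  assumes g: "g \<in> topspace (nerve K (Suc m))" and ij: "i < j" "j \<le> Suc m"
  shows "face_map K (Suc m) i (prism K \<phi> \<theta> (Suc m) j g) = prism K \<phi> \<theta> m (j - 1) (face_map K m i g)"
proof -
  obtain l where l: "j = Suc l" using ij by (cases j) auto
  have v: "vertex K l (face_map K m i g) = vertex K (Suc l) g"
    using vertex_face_map_below[OF g] ij l by simp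
  show ?thesis
  proof (cases "m = 0")
    case True
    then show ?thesis using ij l v by (auto simp: face_map_pos prism_def intro!: restrict_ext)
  next
    case False
    have mult: "gmult K (\<phi> (g k)) (\<phi> (g (Suc k))) = \<phi> (gmult K (g k) (g (Suc k)))" if "1 \<le> k" "k \<le> m" for k
      using hom_mult[OF K.nerve_composable[OF g, of k]] that by simp
    show ?thesis
      unfolding l diff_Suc_1 prism_def[of K \<phi> \<theta> m] v face_map_pos[OF zero_less_Suc]
    proof (intro restrict_ext)
      fix k assume k: "k \<in> {1..Suc m}"
      consider "k < i" | "k = i" | "i < k" "k < Suc l" | "k = Suc l" | q where "k = Suc q" "Suc l \<le> q"
        by (cases k) force+
      then show "(if k < i then prism K \<phi> \<theta> (Suc m) (Suc l) g k
         else if k = i then gmult K (prism K \<phi> \<theta> (Suc m) (Suc l) g i) (prism K \<phi> \<theta> (Suc m) (Suc l) g (Suc i))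
              else prism K \<phi> \<theta> (Suc m) (Suc l) g (Suc k)) =
        (if k \<le> l then \<phi> (face_map K m i g k) else if k = Suc l then \<theta> (vertex K (Suc l) g)
              else face_map K m i g (k - 1))"
        by cases (use k ij l False mult in \<open>auto simp: face_map_pos prism_def\<close>)
    qed
  qed
qed

lemma face_map_prism_above:
  assumes g: "g \<in> topspace (nerve K (Suc m))" and ij: "Suc j < i" "i \<le> Suc (Suc m)"
  shows "face_map K (Suc m) i (prism K \<phi> \<theta> (Suc m) j g) = prism K \<phi> \<theta> m j (face_map K m (i - 1) g)"
proof -
  obtain l where l: "i = Suc l" using ij by (cases i) auto
  have v: "vertex K j (face_map K m l g) = vertex K j g"
    using vertex_face_map_above[OF g] ij l by simp
  show ?thesis
  proof (cases "m = 0")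
    case True
    then show ?thesis using ij l v by (auto simp: face_map_pos prism_def intro!: restrict_ext)
  next
    case False
    show ?thesis
      unfolding l diff_Suc_1 prism_def[of K \<phi> \<theta> m] v face_map_pos[OF zero_less_Suc]
    proof (intro restrict_ext)
      fix k assume k: "k \<in> {1..Suc m}"
      consider "k \<le> j" | "k = Suc j" | q where "k = Suc q" "j < q" "q < l" | "k = Suc l" | q where "k = Suc q" "l < q"
        by (cases k) force+
      then show "(if k < Suc l then prism K \<phi> \<theta> (Suc m) j g k
         else if k = Suc l then gmult K (prism K \<phi> \<theta> (Suc m) j g (Suc l)) (prism K \<phi> \<theta> (Suc m) j g (Suc (Suc l)))
              else prism K \<phi> \<theta> (Suc m) j g (Suc k)) =
        (if k \<le> j then \<phi> (face_map K m l g k) else if k = Suc j then \<theta> (vertex K j g)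
              else face_map K m l g (k - 1))"
        by cases (use k ij l False in \<open>auto simp: face_map_pos prism_def\<close>)
    qed
  qed
qed

text \<open>On units, \<open>\<phi>\<close> is the range of \<open>\<theta>\<close>, and \<open>\<theta>\<close> is etale because it is a section of the source map.\<close>

lemma etale_units: "etale_map (nerve K 0) (nerve K 0) (nerve_map \<phi> 0)"
  by (rule etale_map_cong[OF etale_map_compose[OF etale_map_prism[of 0 0] K.etale_map_face_map[of 1 0]]])
    (use face_map_prism_last[of _ 0] in auto)

end

sublocale natural_transformation_from_id \<subseteq> etale_hom K K \<phi>
  by unfold_locales (rule etale_units)

context natural_transformation_from_id
begin

definition homotopy :: "nat \<Rightarrow> ((nat \<Rightarrow> 'a) \<Rightarrow> int) \<Rightarrow> (nat \<Rightarrow> 'a) \<Rightarrow> int"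
  where "homotopy n f y = (\<Sum>j\<le>n. (- 1) ^ j * pushforward (nerve K n) (prism K \<phi> \<theta> n j) f y)"

lemma homotopy_in_Cc:
  assumes f: "f \<in> Cc (nerve K n)"
  shows "homotopy n f \<in> Cc (nerve K (Suc n))"
  unfolding homotopy_def[abs_def]
  by (intro Cc_sum pushforward_in_Cc etale_map_prism K.Hausdorff_nerve f) auto

text \<open>The prism identities are those of a simplicial homotopy from the identity to \<open>\<phi>\<close>. In degree \<open>0\<close>
  there is no summand \<open>h\<partial>\<close>.\<close>

lemma homotopy_formula:
  assumes f: "f \<in> Cc (nerve K n)"
  shows "boundary K (Suc n) (homotopy n f) y + (if n = 0 then 0 else homotopy (n - 1) (boundary K n f) y)
    = f y - chain_map n f y"
proof -
  let ?Q = "\<lambda>i j. pushforward (nerve K n) (\<lambda>g. face_map K n i (prism K \<phi> \<theta> n j g)) f y"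
  let ?R = "\<lambda>j i. pushforward (nerve K n) (\<lambda>g. prism K \<phi> \<theta> (n - 1) j (face_map K (n - 1) i g)) f y"
  have 1: "boundary K (Suc n) (homotopy n f) y = (\<Sum>i\<le>Suc n. \<Sum>j\<le>n. (- 1) ^ i * ((- 1) ^ j * ?Q i j))"
  proof -
    have "boundary K (Suc n) (homotopy n f) y = (\<Sum>i\<le>Suc n. (- 1) ^ i * (\<Sum>j\<le>n. (- 1) ^ j *
          pushforward (nerve K (Suc n)) (face_map K n i) (pushforward (nerve K n) (prism K \<phi> \<theta> n j) f) y))"
      unfolding boundary_eq homotopy_def[abs_def]
      by (intro sum.cong refl arg_cong2[where f = "(*)"] pushforward_sum[OF K.etale_map_face_map]
          pushforward_in_Cc[OF etale_map_prism] K.Hausdorff_nerve f) auto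
    also have "\<dots> = (\<Sum>i\<le>Suc n. \<Sum>j\<le>n. (- 1) ^ i * ((- 1) ^ j * ?Q i j))"
      by (simp only: sum_distrib_left, intro sum.cong refl,
          subst pushforward_compose[OF etale_map_prism K.etale_map_face_map f]) auto
    finally show ?thesis .
  qed
  have 2: "(if n = 0 then 0 else homotopy (n - 1) (boundary K n f) y) =
     (\<Sum>j<n. \<Sum>i\<le>n. (- 1) ^ j * ((- 1) ^ i * ?R j i))"
  proof (cases n)
    case (Suc m)
    have f': "f \<in> Cc (nerve K (Suc m))" using f Suc by simp
    have "homotopy m (boundary K (Suc m) f) y = (\<Sum>j\<le>m. (- 1) ^ j * (\<Sum>i\<le>Suc m. (- 1) ^ i *
          pushforward (nerve K m) (prism K \<phi> \<theta> m j) (pushforward (nerve K (Suc m)) (face_map K m i) f) y))"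
      unfolding homotopy_def boundary_eq[abs_def]
      by (intro sum.cong refl arg_cong2[where f = "(*)"] pushforward_sum[OF etale_map_prism]
          pushforward_in_Cc[OF K.etale_map_face_map] K.Hausdorff_nerve f') auto
    also have "\<dots> = (\<Sum>j\<le>m. \<Sum>i\<le>Suc m. (- 1) ^ j * ((- 1) ^ i *
          pushforward (nerve K (Suc m)) (\<lambda>g. prism K \<phi> \<theta> m j (face_map K m i g)) f y))"
      by (simp only: sum_distrib_left, intro sum.cong refl,
          subst pushforward_compose[OF K.etale_map_face_map etale_map_prism f']) auto
    finally show ?thesis using Suc by (simp add: lessThan_Suc_atMost del: sum.atMost_Suc)
  qed simp
  have "(\<Sum>i\<le>Suc n. \<Sum>j\<le>n. (- 1) ^ i * ((- 1) ^ j * ?Q i j)) +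
     (\<Sum>j<n. \<Sum>i\<le>n. (- 1) ^ j * ((- 1) ^ i * ?R j i)) = ?Q 0 0 - ?Q (Suc n) n"
  proof (rule homotopy_double_sum)
    fix i j assume ij: "i < j" "j \<le> n"
    then obtain m where n: "n = Suc m" by (cases n) auto
    show "?Q i j = ?R (j - 1) i"
      by (rule fun_cong[OF pushforward_cong]) (use face_map_prism_below ij n in auto)
  next
    fix i j assume ij: "Suc j < i" "i \<le> Suc n"
    then obtain m where n: "n = Suc m" by (cases n) auto
    show "?Q i j = ?R j (i - 1)"
      by (rule fun_cong[OF pushforward_cong]) (use face_map_prism_above ij n in auto)
  next
    fix j assume "j < n"
    then show "?Q (Suc j) (Suc j) = ?Q (Suc j) j"
      by (intro fun_cong[OF pushforward_cong] face_map_prism_middle)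
  qed
  moreover have "?Q 0 0 = f y"
    using pushforward_cong[of "nerve K n" "\<lambda>g. face_map K n 0 (prism K \<phi> \<theta> n 0 g)" "\<lambda>g. g" f, OF face_map_prism_first] pushforward_id[OF f]
    by simp
  moreover have "?Q (Suc n) n = chain_map n f y"
    unfolding chain_map_def by (intro fun_cong[OF pushforward_cong] face_map_prism_last)
  ultimately show ?thesis unfolding 1 2 by simp
qed

lemma cycle_homologous_chain:
  assumes f: "f \<in> cycles K n"
  shows "(\<lambda>y. f y - chain_map n f y) \<in> boundaries K n"
proof -
  have fC: "f \<in> Cc (nerve K n)" and fb: "boundary K n f = (\<lambda>x. 0)" using f by (auto simp: cycles_def)
  have h0: "homotopy m (\<lambda>x. 0) y = 0" for m y
    by (simp add: homotopy_def pushforward_def)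
  have "(\<lambda>y. f y - chain_map n f y) = boundary K (Suc n) (homotopy n f)"
  proof
    fix y
    show "f y - chain_map n f y = boundary K (Suc n) (homotopy n f) y"
      using homotopy_formula[OF fC, of y] unfolding fb h0 by simp
  qed
  then show ?thesis unfolding boundaries_def using homotopy_in_Cc[OF fC] by blast
qed

end

section \<open>The skew product and the identity component\<close>

locale graded_etale_groupoid = Hausdorff_etale_groupoid G + graded_groupoid G \<Gamma> c
  for G :: "'a top_groupoid" and \<Gamma> :: "('g, 'k) monoid_scheme" and c :: "'a \<Rightarrow> 'g"
begin

abbreviation "K \<equiv> skew_product \<Gamma> G c"
abbreviation "L \<equiv> identity_subgroupoid \<Gamma> G c"

lemma grade_closed: "g \<in> garr G \<Longrightarrow> c g \<in> carrier \<Gamma>"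
  using continuous_grading by (auto simp: continuous_map_def garr_def)

lemma grade_unit:
  assumes u: "u \<in> gunits G"
  shows "c u = \<one>\<^bsub>\<Gamma>\<^esub>"
proof -
  have "u \<in> garr G" and s: "gsrc G u = u" using u by (auto simp: gunits_iff)
  then have "c u = c u \<otimes>\<^bsub>\<Gamma>\<^esub> c u"
    using grading_mult[of u u] mult_src[of u] rng_unit[OF u] by (simp add: composable_def)
  then show ?thesis using grade_closed[OF \<open>u \<in> garr G\<close>] \<Gamma>.r_cancel_one' by metis
qed

lemma grade_inv:
  assumes g: "g \<in> garr G"
  shows "c (ginv G g) = inv\<^bsub>\<Gamma>\<^esub> (c g)"
proof -
  have "c (ginv G g) \<otimes>\<^bsub>\<Gamma>\<^esub> c g = \<one>\<^bsub>\<Gamma>\<^esub>"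
    using grading_mult[OF composable_inv_left[OF g]] grade_unit[OF src_in_gunits[OF g]]
    by (simp add: gsrc_def)
  then show ?thesis using grade_closed[OF g] grade_closed[OF inv_closed[OF g]] \<Gamma>.inv_equality by metis
qed

lemma gtop_skew: "gtop K = prod_topology (gtop G) (discrete_topology (carrier \<Gamma>))"
  by (simp add: skew_product_def)

lemma gmult_skew: "gmult K p q = (gmult G (fst p) (fst q), snd q)"
  by (cases p; cases q) (simp add: skew_product_def)

lemma ginv_skew: "ginv K p = (ginv G (fst p), c (fst p) \<otimes>\<^bsub>\<Gamma>\<^esub> snd p)"
  by (cases p) (simp add: skew_product_def)

lemma gsrc_skew: "gsrc K p = (gsrc G (fst p), snd p)"
  by (cases p) (simp add: gsrc_skew_product)

lemma grng_skew: "grng K p = (grng G (fst p), c (fst p) \<otimes>\<^bsub>\<Gamma>\<^esub> snd p)"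
  by (cases p) (simp add: grng_skew_product)

lemma composable_skew: "composable K p q \<longleftrightarrow> composable G (fst p) (fst q) \<and> snd q \<in> carrier \<Gamma> \<and>
    snd p = c (fst q) \<otimes>\<^bsub>\<Gamma>\<^esub> snd q"
proof -
  have "c (fst q) \<otimes>\<^bsub>\<Gamma>\<^esub> snd q \<in> carrier \<Gamma>"
    if "composable G (fst p) (fst q)" "snd q \<in> carrier \<Gamma>"
    using that by (simp add: composable_def grade_closed)
  then show ?thesis
    using composable_skew_product[of \<Gamma> G c "fst p" "snd p" "fst q" "snd q"] by auto
qed

lemma gunits_skew: "gunits K = gunits G \<times> carrier \<Gamma>"
proof -
  have "gunits K = (\<lambda>p. (gsrc G (fst p), snd p)) ` (garr G \<times> carrier \<Gamma>)"
    by (simp add: gunits_def garr_skew_product gsrc_skew)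
  also have "\<dots> = (gsrc G ` garr G) \<times> carrier \<Gamma>" by force
  finally show ?thesis by (simp only: gunits_def[of G])
qed

lemma unit_space_skew: "unit_space K = prod_topology (unit_space G) (discrete_topology (carrier \<Gamma>))"
proof -
  have "prod_topology (unit_space G) (discrete_topology (carrier \<Gamma>)) =
      prod_topology (unit_space G) (subtopology (discrete_topology (carrier \<Gamma>)) (carrier \<Gamma>))"
    by simp
  then show ?thesis by (simp only: unit_space_def gtop_skew gunits_skew subtopology_Times)
qed

lemma groupoid_skew: "groupoid K"
proof
  show "gmult K g h \<in> garr K" if "composable K g h" for g h
    using that mult_closed by (auto simp: composable_skew garr_skew_product gmult_skew)
  show "ginv K g \<in> garr K" if "g \<in> garr K" for g
    using that inv_closed grade_closed by (auto simp: garr_skew_product ginv_skew)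
  show "ginv K (ginv K g) = g" if "g \<in> garr K" for g
  proof -
    have g: "fst g \<in> garr G" "snd g \<in> carrier \<Gamma>" using that by (auto simp: garr_skew_product)
    then have "inv\<^bsub>\<Gamma>\<^esub> c (fst g) \<otimes>\<^bsub>\<Gamma>\<^esub> (c (fst g) \<otimes>\<^bsub>\<Gamma>\<^esub> snd g) = snd g"
      using grade_closed[OF g(1)] \<Gamma>.inv_solve_left' by (metis \<Gamma>.inv_closed \<Gamma>.l_inv \<Gamma>.l_one \<Gamma>.m_assoc)
    then show ?thesis using g by (simp add: ginv_skew inv_inv grade_inv prod_eq_iff)
  qed
  show "gsrc K (gmult K g h) = gsrc K h" if "composable K g h" for g h
    using that src_mult by (auto simp: composable_skew gsrc_skew gmult_skew)
  show "grng K (gmult K g h) = grng K g" if "composable K g h" for g h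
  proof -
    have gh: "composable G (fst g) (fst h)" "snd h \<in> carrier \<Gamma>" "snd g = c (fst h) \<otimes>\<^bsub>\<Gamma>\<^esub> snd h"
      using that by (auto simp: composable_skew)
    then have "c (fst g) \<in> carrier \<Gamma>" "c (fst h) \<in> carrier \<Gamma>" by (auto simp: composable_def grade_closed)
    then show ?thesis using gh rng_mult by (simp add: grng_skew gmult_skew grading_mult \<Gamma>.m_assoc)
  qed
  show "gmult K (gmult K g h) k = gmult K g (gmult K h k)" if "composable K g h" "composable K h k" for g h k
    using that mult_assoc by (auto simp: composable_skew gmult_skew)
  show "gmult K (ginv K g) (gmult K g h) = h" if "composable K g h" for g h
    using that inv_mult_cancel by (auto simp: composable_skew gmult_skew ginv_skew prod_eq_iff)
  show "gmult K (gmult K g h) (ginv K h) = g" if "composable K g h" for g h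
    using that mult_inv_cancel by (auto simp: composable_skew gmult_skew ginv_skew prod_eq_iff)
qed

lemma continuous_map_grade_mult:
  "continuous_map (gtop K) (discrete_topology (carrier \<Gamma>)) (\<lambda>p. c (fst p) \<otimes>\<^bsub>\<Gamma>\<^esub> snd p)"
  unfolding continuous_map_def
proof (intro conjI allI impI)
  show "(\<lambda>p. c (fst p) \<otimes>\<^bsub>\<Gamma>\<^esub> snd p) \<in> topspace (gtop K) \<rightarrow> topspace (discrete_topology (carrier \<Gamma>))"
    by (auto simp: gtop_skew grade_closed garr_def)
  fix V
  let ?S = "{p \<in> topspace (gtop K). c (fst p) \<otimes>\<^bsub>\<Gamma>\<^esub> snd p \<in> V}"
  show "openin (gtop K) ?S"
    unfolding gtop_skew openin_prod_topology_alt
  proof (intro allI impI)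
    fix x \<alpha> assume "(x, \<alpha>) \<in> {p \<in> topspace (prod_topology (gtop G) (discrete_topology (carrier \<Gamma>))). c (fst p) \<otimes>\<^bsub>\<Gamma>\<^esub> snd p \<in> V}"
    then have x: "x \<in> topspace (gtop G)" "\<alpha> \<in> carrier \<Gamma>" "c x \<otimes>\<^bsub>\<Gamma>\<^esub> \<alpha> \<in> V" by auto
    let ?U = "{x' \<in> topspace (gtop G). c x' \<in> {c x}}"
    have "openin (gtop G) ?U"
      using x(1) by (intro openin_continuous_map_preimage[OF continuous_grading]) (auto simp: grade_closed garr_def)
    then show "\<exists>U V'. openin (gtop G) U \<and> openin (discrete_topology (carrier \<Gamma>)) V' \<and> x \<in> U \<and> \<alpha> \<in> V' \<and>
       U \<times> V' \<subseteq> {p \<in> topspace (prod_topology (gtop G) (discrete_topology (carrier \<Gamma>))). c (fst p) \<otimes>\<^bsub>\<Gamma>\<^esub> snd p \<in> V}"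
      using x by (intro exI[of _ ?U] exI[of _ "{\<alpha>}"]) auto
  qed
qed

lemma Hausdorff_etale_groupoid_skew: "Hausdorff_etale_groupoid K"
proof -
  interpret K: groupoid K by (rule groupoid_skew)
  let ?D = "discrete_topology (carrier \<Gamma>)"
  let ?C = "subtopology (prod_topology (gtop K) (gtop K)) {(g, h). composable K g h}"
  have 1: "continuous_map ?C (gtop K) fst" "continuous_map ?C (gtop K) snd"
    by (auto intro: continuous_map_from_subtopology continuous_map_fst continuous_map_snd)
  have f: "continuous_map (gtop K) (gtop G) fst" "continuous_map (gtop K) ?D snd"
    unfolding gtop_skew by (auto intro: continuous_map_fst continuous_map_snd)
  show ?thesis
  proof unfold_locales
    have "continuous_map ?C (gtop G) (\<lambda>z. gmult G (fst (fst z)) (fst (snd z)))"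
      using continuous_map_compose[OF 1(1) f(1)] continuous_map_compose[OF 1(2) f(1)]
      by (intro continuous_map_gmult) (auto simp: o_def composable_skew)
    moreover have "continuous_map ?C ?D (\<lambda>z. snd (snd z))"
      using continuous_map_compose[OF 1(2) f(2)] by (simp add: o_def)
    ultimately have "continuous_map ?C (gtop K) (\<lambda>z. (gmult G (fst (fst z)) (fst (snd z)), snd (snd z)))"
      unfolding gtop_skew by (rule continuous_map_pairedI)
    moreover have "(\<lambda>(g, h). gmult K g h) = (\<lambda>z. (gmult G (fst (fst z)) (fst (snd z)), snd (snd z)))"
      by (auto simp: gmult_skew)
    ultimately show "continuous_map ?C (gtop K) (\<lambda>(g, h). gmult K g h)" by simp
    have "continuous_map (gtop K) (prod_topology (gtop G) ?D) (\<lambda>p. (ginv G (fst p), c (fst p) \<otimes>\<^bsub>\<Gamma>\<^esub> snd p))"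
      using f(1) by (intro continuous_map_pairedI continuous_map_ginv continuous_map_grade_mult)
    then show "continuous_map (gtop K) (gtop K) (ginv K)"
      unfolding gtop_skew[symmetric] by (simp add: ginv_skew[abs_def])
    show "Hausdorff_space (gtop K)"
      unfolding gtop_skew by (simp add: Hausdorff_space_prod_topology Hausdorff_gtop)
    show "etale_map (gtop K) (unit_space K) (gsrc K)"
      unfolding gtop_skew unit_space_skew gsrc_skew[abs_def] by (rule etale_map_times_id[OF etale_src])
  qed
qed

lemma garr_identity: "garr L = {g \<in> garr G. c g = \<one>\<^bsub>\<Gamma>\<^esub>}"
  unfolding garr_def identity_subgroupoid_def homogeneous_part_def by auto

lemma gtop_identity: "gtop L = subtopology (gtop G) (garr L)"
  unfolding garr_identity by (simp add: identity_subgroupoid_def homogeneous_part_def)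

lemma identity_ops: "gmult L = gmult G" "ginv L = ginv G" "gsrc L = gsrc G" "grng L = grng G"
  by (auto simp: identity_subgroupoid_def gsrc_def grng_def)

lemma composable_identity: "composable L g h \<longleftrightarrow> composable G g h \<and> c g = \<one>\<^bsub>\<Gamma>\<^esub> \<and> c h = \<one>\<^bsub>\<Gamma>\<^esub>"
  by (auto simp: composable_def garr_identity identity_ops)

lemma openin_identity: "openin (gtop G) (garr L)"
proof -
  have "openin (gtop G) {g \<in> topspace (gtop G). c g \<in> {\<one>\<^bsub>\<Gamma>\<^esub>}}"
    by (rule openin_continuous_map_preimage[OF continuous_grading]) simp
  then show ?thesis unfolding garr_identity by (simp add: garr_def[of G])
qed

lemma gunits_identity: "gunits L = gunits G"
proof
  show "gunits L \<subseteq> gunits G" by (auto simp: gunits_def garr_identity identity_ops)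
  show "gunits G \<subseteq> gunits L"
  proof
    fix u assume u: "u \<in> gunits G"
    then have "u \<in> garr L" using grade_unit[OF u] by (simp add: garr_identity gunits_iff)
    then show "u \<in> gunits L" unfolding gunits_def[of L] identity_ops
      by (rule rev_image_eqI) (use u in \<open>simp add: gunits_iff\<close>)
  qed
qed

text \<open>Units have degree \<open>\<epsilon>\<close>, so the identity component contains all of them.\<close>

lemma unit_space_identity: "unit_space L = unit_space G"
proof -
  have "garr L \<inter> gunits G = gunits G"
    using grade_unit by (auto simp: garr_identity gunits_iff)
  then show ?thesis by (simp add: unit_space_def gtop_identity gunits_identity subtopology_subtopology)
qed

lemma Hausdorff_etale_groupoid_identity: "Hausdorff_etale_groupoid L"
proof
  show "gmult L g h \<in> garr L" if "composable L g h" for g h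
    using that mult_closed grading_mult by (auto simp: composable_identity garr_identity identity_ops)
  show "ginv L g \<in> garr L" if "g \<in> garr L" for g
    using that inv_closed grade_inv by (auto simp: garr_identity identity_ops)
  show "ginv L (ginv L g) = g" if "g \<in> garr L" for g
    using that inv_inv by (auto simp: garr_identity identity_ops)
  show "gsrc L (gmult L g h) = gsrc L h" if "composable L g h" for g h
    using that src_mult by (auto simp: composable_identity identity_ops)
  show "grng L (gmult L g h) = grng L g" if "composable L g h" for g h
    using that rng_mult by (auto simp: composable_identity identity_ops)
  show "gmult L (gmult L g h) k = gmult L g (gmult L h k)" if "composable L g h" "composable L h k" for g h k
    using that mult_assoc by (auto simp: composable_identity identity_ops)
  show "gmult L (ginv L g) (gmult L g h) = h" if "composable L g h" for g h
    using that inv_mult_cancel by (auto simp: composable_identity identity_ops)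
  show "gmult L (gmult L g h) (ginv L h) = g" if "composable L g h" for g h
    using that mult_inv_cancel by (auto simp: composable_identity identity_ops)
  have mL: "gmult G g h \<in> garr L" if "composable L g h" for g h
    using that mult_closed grading_mult by (auto simp: composable_identity garr_identity)
  have i: "continuous_map (gtop L) (gtop G) (\<lambda>x. x)"
    unfolding gtop_identity by (intro continuous_map_from_subtopology continuous_map_id[unfolded id_def])
  let ?C = "subtopology (prod_topology (gtop L) (gtop L)) {(g, h). composable L g h}"
  have 1: "continuous_map ?C (gtop L) fst" "continuous_map ?C (gtop L) snd"
    by (auto intro: continuous_map_from_subtopology continuous_map_fst continuous_map_snd)
  have "continuous_map ?C (gtop G) (\<lambda>z. gmult G (fst z) (snd z))"
    using continuous_map_compose[OF 1(1) i] continuous_map_compose[OF 1(2) i]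
    by (intro continuous_map_gmult) (auto simp: o_def composable_identity)
  then have "continuous_map ?C (subtopology (gtop G) (garr L)) (\<lambda>z. gmult G (fst z) (snd z))"
    using mL by (auto simp: continuous_map_in_subtopology)
  then show "continuous_map ?C (gtop L) (\<lambda>(g, h). gmult L g h)"
    unfolding gtop_identity[symmetric] by (simp add: identity_ops case_prod_unfold)
  have "continuous_map (gtop L) (gtop G) (ginv G)" using continuous_map_ginv[OF i] by simp
  then have "continuous_map (gtop L) (subtopology (gtop G) (garr L)) (ginv G)"
    using inv_closed grade_inv by (auto simp: continuous_map_in_subtopology garr_def[of L, symmetric] garr_identity)
  then show "continuous_map (gtop L) (gtop L) (ginv L)"
    unfolding gtop_identity[symmetric] by (simp add: identity_ops)
  show "Hausdorff_space (gtop L)"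
    unfolding gtop_identity using Hausdorff_gtop by (rule Hausdorff_space_subtopology)
  show "etale_map (gtop L) (unit_space L) (gsrc L)"
    unfolding unit_space_identity identity_ops unfolding gtop_identity
    by (rule etale_map_restrict_open[OF etale_src openin_identity])
qed

sublocale K: Hausdorff_etale_groupoid K by (rule Hausdorff_etale_groupoid_skew)
sublocale L: Hausdorff_etale_groupoid L by (rule Hausdorff_etale_groupoid_identity)

definition incl :: "'a \<Rightarrow> 'a \<times> 'g"
  where "incl x = (x, \<one>\<^bsub>\<Gamma>\<^esub>)"

sublocale incl: groupoid_hom L K incl
proof
  show "continuous_map (gtop L) (gtop K) incl"
    unfolding gtop_skew incl_def[abs_def] gtop_identity
    by (intro continuous_map_pairedI continuous_map_from_subtopology) (auto simp: continuous_map_id[unfolded id_def])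
  show "incl (gmult L g h) = gmult K (incl g) (incl h)" for g h
    by (simp add: incl_def gmult_skew identity_ops)
  show "gsrc K (incl g) = incl (gsrc L g)" for g
    by (simp add: incl_def gsrc_skew identity_ops)
  show "grng K (incl g) = incl (grng L g)" if "g \<in> garr L" for g
    using that by (simp add: incl_def grng_skew identity_ops garr_identity)
qed

text \<open>The first projection is a continuous left inverse of the inclusion on units, whose image is the
  open set of all objects of colour \<open>\<epsilon>\<close>.\<close>

sublocale incl: etale_hom L K incl
proof
  have c1: "continuous_map (nerve K 0) (gtop K) (\<lambda>g. g 1)"
    by (rule K.continuous_map_nerve_proj) simp
  have f: "continuous_map (nerve K 0) (gtop G) (\<lambda>g. fst (g 1))" "continuous_map (nerve K 0) (discrete_topology (carrier \<Gamma>)) (\<lambda>g. snd (g 1))"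
    using continuous_map_compose[OF c1[unfolded gtop_skew] continuous_map_fst]
      continuous_map_compose[OF c1[unfolded gtop_skew] continuous_map_snd]
    by (simp_all add: o_def)
  have u: "fst (g 1) \<in> gunits G" if "g \<in> topspace (nerve K 0)" for g
    using that by (auto simp: K.nerve_iff gunits_skew)
  then have uL: "fst (g 1) \<in> garr L" if "g \<in> topspace (nerve K 0)" for g
    using that grade_unit by (auto simp: garr_identity gunits_iff)
  show "etale_map (nerve L 0) (nerve K 0) (nerve_map incl 0)"
  proof (rule etale_map_open_embedding[OF incl.continuous_map_nerve_map])
    show "continuous_map (nerve K 0) (nerve L 0) (nerve_map fst 0)"
    proof (rule L.continuous_map_into_nerve)
      show "nerve_map fst 0 g \<in> topspace (nerve L 0)" if "g \<in> topspace (nerve K 0)" for g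
        using u[OF that] uL[OF that] by (auto simp: L.nerve_iff nerve_map_def gunits_identity)
      show "continuous_map (nerve K 0) (gtop L) (\<lambda>g. nerve_map fst 0 g j)" if "j \<in> {1..max 1 0}" for j
        using f(1) uL that by (auto simp: gtop_identity continuous_map_in_subtopology nerve_map_def)
    qed
    show "nerve_map fst 0 (nerve_map incl 0 g) = g" if "g \<in> topspace (nerve L 0)" for g
      using that by (auto simp: nerve_map_def incl_def L.nerve_iff fun_eq_iff extensional_def)
    have "nerve_map incl 0 ` topspace (nerve L 0) = {g \<in> topspace (nerve K 0). snd (g 1) \<in> {\<one>\<^bsub>\<Gamma>\<^esub>}}"
    proof (intro equalityI subsetI)
      fix g assume "g \<in> nerve_map incl 0 ` topspace (nerve L 0)"
      then obtain h where h: "h \<in> topspace (nerve L 0)" "g = nerve_map incl 0 h" by blast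
      have "snd (nerve_map incl 0 h 1) = \<one>\<^bsub>\<Gamma>\<^esub>" by (simp add: nerve_map_def incl_def)
      then show "g \<in> {g \<in> topspace (nerve K 0). snd (g 1) \<in> {\<one>\<^bsub>\<Gamma>\<^esub>}}"
        using incl.nerve_map_in_nerve[OF h(1)] h(2) by simp
    next
      fix g assume g: "g \<in> {g \<in> topspace (nerve K 0). snd (g 1) \<in> {\<one>\<^bsub>\<Gamma>\<^esub>}}"
      have "nerve_map fst 0 g \<in> topspace (nerve L 0)"
        using g u uL by (auto simp: L.nerve_iff nerve_map_def gunits_identity)
      moreover have "g = nerve_map incl 0 (nerve_map fst 0 g)"
        using g by (auto simp: nerve_map_def incl_def K.nerve_iff fun_eq_iff extensional_def prod_eq_iff)
      ultimately show "g \<in> nerve_map incl 0 ` topspace (nerve L 0)" by blast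
    qed
    moreover have "openin (nerve K 0) {g \<in> topspace (nerve K 0). snd (g 1) \<in> {\<one>\<^bsub>\<Gamma>\<^esub>}}"
      by (rule openin_continuous_map_preimage[OF f(2)]) simp
    ultimately show "openin (nerve K 0) (nerve_map incl 0 ` topspace (nerve L 0))" by simp
  qed
qed

end

section \<open>Retraction of the skew product onto the identity component\<close>

text \<open>The arrow \<open>(b p, \<alpha>)\<close> of the skew product joins the object \<open>p = (u, \<alpha>)\<close> to an object of colour
  \<open>\<epsilon>\<close>. The normalisation on colour \<open>\<epsilon>\<close> is what makes the retraction below a left inverse of
  the inclusion on the nose.\<close>

locale graded_groupoid_with_sections = graded_etale_groupoid G \<Gamma> c
  for G :: "'a top_groupoid" and \<Gamma> :: "('g, 'k) monoid_scheme" and c :: "'a \<Rightarrow> 'g" +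
  fixes b :: "'a \<times> 'g \<Rightarrow> 'a"
  assumes section_continuous: "continuous_map (unit_space K) (gtop G) b"
    and section_src: "p \<in> gunits K \<Longrightarrow> gsrc G (b p) = fst p"
    and section_grade: "p \<in> gunits K \<Longrightarrow> c (b p) = inv\<^bsub>\<Gamma>\<^esub> (snd p)"
    and section_identity: "u \<in> gunits G \<Longrightarrow> b (u, \<one>\<^bsub>\<Gamma>\<^esub>) = u"
begin

lemma section_closed: "p \<in> gunits K \<Longrightarrow> b p \<in> garr G"
  using section_continuous by (auto simp: continuous_map_def garr_def K.topspace_unit_space)

text \<open>Conjugation by \<open>b\<close>. It carries an arrow between objects \<open>p\<close> and \<open>q\<close> to an arrow from \<open>r(b p)\<close> to \<open>r(b q)\<close>.\<close>

definition retract :: "'a \<times> 'g \<Rightarrow> 'a"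
  where "retract p = gmult G (gmult G (b (grng K p)) (fst p)) (ginv G (b (gsrc K p)))"

definition transform :: "'a \<times> 'g \<Rightarrow> 'a \<times> 'g"
  where "transform p = (b p, snd p)"

lemma section_rng_composable: "p \<in> garr K \<Longrightarrow> composable G (b (grng K p)) (fst p)"
  using section_closed[OF K.rng_in_gunits] section_src[OF K.rng_in_gunits]
  by (auto simp: composable_def garr_skew_product grng_skew)

lemma fst_composable_section_src:
  assumes "p \<in> garr K"
  shows "composable G (gmult G (b (grng K p)) (fst p)) (ginv G (b (gsrc K p)))"
  using assms section_rng_composable[OF assms] section_closed[OF K.src_in_gunits[OF assms]]
    section_src[OF K.src_in_gunits[OF assms]]
  by (simp add: composable_def mult_closed src_mult inv_closed rng_inv gsrc_skew garr_skew_product)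

text \<open>This equation is the naturality of \<open>b\<close>; it also determines \<open>retract p\<close>.\<close>

lemma retract_mult_section:
  assumes p: "p \<in> garr K"
  shows "gmult G (retract p) (b (gsrc K p)) = gmult G (b (grng K p)) (fst p)"
  using mult_inv_cancel[OF fst_composable_section_src[OF p]] section_closed[OF K.src_in_gunits[OF p]]
  by (simp add: retract_def inv_inv)

lemma src_retract: "p \<in> garr K \<Longrightarrow> gsrc G (retract p) = grng G (b (gsrc K p))"
  using src_mult[OF fst_composable_section_src] section_closed[OF K.src_in_gunits]
  by (simp add: retract_def src_inv)

lemma rng_retract: "p \<in> garr K \<Longrightarrow> grng G (retract p) = grng G (b (grng K p))"
  using rng_mult[OF fst_composable_section_src] rng_mult[OF section_rng_composable]
  by (simp add: retract_def)

lemma retract_closed: "p \<in> garr K \<Longrightarrow> retract p \<in> garr G"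
  using mult_closed[OF fst_composable_section_src] by (simp add: retract_def)

text \<open>The degree is \<open>(c(x)\<alpha>)\<inverse> c(x) \<alpha> = \<epsilon>\<close>.\<close>

lemma grade_retract:
  assumes p: "p \<in> garr K"
  shows "c (retract p) = \<one>\<^bsub>\<Gamma>\<^esub>"
proof -
  have arr: "fst p \<in> garr G" "snd p \<in> carrier \<Gamma>" using p by (auto simp: garr_skew_product)
  note g = grade_closed[OF arr(1)]
  have "c (retract p) = (inv\<^bsub>\<Gamma>\<^esub> (c (fst p) \<otimes>\<^bsub>\<Gamma>\<^esub> snd p) \<otimes>\<^bsub>\<Gamma>\<^esub> c (fst p)) \<otimes>\<^bsub>\<Gamma>\<^esub> snd p"
    using grading_mult[OF fst_composable_section_src[OF p]] grading_mult[OF section_rng_composable[OF p]]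
      section_grade[OF K.rng_in_gunits[OF p]] section_grade[OF K.src_in_gunits[OF p]]
      grade_inv[OF section_closed[OF K.src_in_gunits[OF p]]] arr
    by (simp add: retract_def gsrc_skew grng_skew)
  also have "\<dots> = \<one>\<^bsub>\<Gamma>\<^esub>" using g arr(2) by (simp add: \<Gamma>.m_assoc)
  finally show ?thesis .
qed

lemma retract_unit:
  assumes p: "p \<in> gunits K"
  shows "retract p = grng G (b p)"
proof -
  have "gsrc K p = p" "grng K p = p" using K.src_unit[OF p] K.rng_unit[OF p] by auto
  moreover have "gmult G (b p) (fst p) = b p"
    using mult_src[OF section_closed[OF p]] section_src[OF p] by simp
  ultimately show ?thesis by (simp add: retract_def grng_def)
qed

lemma continuous_map_section:
  assumes "continuous_map X (unit_space K) f"
  shows "continuous_map X (gtop G) (\<lambda>x. b (f x))"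
  using continuous_map_compose[OF assms section_continuous] by (simp add: o_def)

lemma continuous_map_retract: "continuous_map (gtop K) (gtop L) retract"
proof -
  have id: "continuous_map (gtop K) (gtop K) (\<lambda>p. p)" using continuous_map_id[of "gtop K"] by (simp add: id_def)
  have s: "continuous_map (gtop K) (unit_space K) (gsrc K)" by (rule etale_mapD(1)[OF K.etale_src])
  have r: "continuous_map (gtop K) (unit_space K) (grng K)"
    using K.continuous_map_grng[OF id] K.rng_in_gunits
    by (auto simp: unit_space_def continuous_map_in_subtopology garr_def)
  have f: "continuous_map (gtop K) (gtop G) fst" unfolding gtop_skew by (rule continuous_map_fst)
  have tK: "topspace (gtop K) = garr K" by (simp add: garr_def)
  have "continuous_map (gtop K) (gtop G) retract"
    unfolding retract_def[abs_def]
    by (intro continuous_map_gmult continuous_map_ginv continuous_map_section r s f)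
      (auto simp: tK section_rng_composable fst_composable_section_src)
  then show ?thesis
    unfolding gtop_identity by (auto simp: continuous_map_in_subtopology tK garr_identity retract_closed grade_retract)
qed

text \<open>The inner factors \<open>b(v)\<inverse>\<close> and \<open>b(v)\<close> at the middle object \<open>v\<close> cancel.\<close>

lemma retract_mult:
  assumes pq: "composable K p q"
  shows "retract (gmult K p q) = gmult G (retract p) (retract q)"
proof -
  have p: "p \<in> garr K" and q: "q \<in> garr K" and sr: "gsrc K p = grng K q" using pq by (auto simp: composable_def)
  have xy: "composable G (fst p) (fst q)" using pq by (simp add: composable_skew)
  let ?B1 = "b (grng K p)" and ?B2 = "b (grng K q)" and ?B3 = "b (gsrc K q)"
  have 1: "composable G ?B1 (fst p)" "composable G ?B2 (fst q)" using section_rng_composable p q by auto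
  have 2: "composable G (gmult G ?B2 (fst q)) (ginv G ?B3)" by (rule fst_composable_section_src[OF q])
  have 3: "composable G (retract p) ?B2"
    using retract_closed[OF p] section_closed[OF K.rng_in_gunits[OF q]] src_retract[OF p] sr
    by (simp add: composable_def)
  have 4: "composable G (retract p) (gmult G ?B2 (fst q))"
    using 1(2) 3 by (simp add: composable_def mult_closed rng_mult)
  have "gmult G (retract p) (retract q) = gmult G (gmult G (retract p) (gmult G ?B2 (fst q))) (ginv G ?B3)"
    using mult_assoc[OF 4 2] by (simp add: retract_def[of q])
  also have "gmult G (retract p) (gmult G ?B2 (fst q)) = gmult G (gmult G (retract p) ?B2) (fst q)"
    using mult_assoc[OF 3 1(2)] by simp
  also have "gmult G (retract p) ?B2 = gmult G ?B1 (fst p)"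
    using retract_mult_section[OF p] sr by simp
  also have "gmult G (gmult G ?B1 (fst p)) (fst q) = gmult G ?B1 (gmult G (fst p) (fst q))"
    by (rule mult_assoc[OF 1(1) xy])
  also have "gmult G (gmult G ?B1 (gmult G (fst p) (fst q))) (ginv G ?B3) = retract (gmult K p q)"
    using K.src_mult[OF pq] K.rng_mult[OF pq] by (simp add: retract_def gmult_skew)
  finally show ?thesis by simp
qed

sublocale retract: groupoid_hom K L retract
proof
  show "continuous_map (gtop K) (gtop L) retract" by (rule continuous_map_retract)
  show "retract (gmult K g h) = gmult L (retract g) (retract h)" if "composable K g h" for g h
    using retract_mult[OF that] by (simp add: identity_ops)
  show "gsrc L (retract g) = retract (gsrc K g)" if "g \<in> garr K" for g
    using src_retract[OF that] retract_unit[OF K.src_in_gunits[OF that]] by (simp add: identity_ops)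
  show "grng L (retract g) = retract (grng K g)" if "g \<in> garr K" for g
    using rng_retract[OF that] retract_unit[OF K.rng_in_gunits[OF that]] by (simp add: identity_ops)
qed

sublocale endo: groupoid_hom K K "\<lambda>p. incl (retract p)"
proof
  show "continuous_map (gtop K) (gtop K) (\<lambda>p. incl (retract p))"
    using continuous_map_compose[OF continuous_map_retract incl.hom_continuous] by (simp add: o_def)
  show "incl (retract (gmult K g h)) = gmult K (incl (retract g)) (incl (retract h))" if "composable K g h" for g h
    using that by (simp add: retract.hom_mult incl.hom_mult retract.hom_composable)
  show "gsrc K (incl (retract g)) = incl (retract (gsrc K g))" if "g \<in> garr K" for g
    using that by (simp add: retract.hom_src incl.hom_src retract.hom_closed)
  show "grng K (incl (retract g)) = incl (retract (grng K g))" if "g \<in> garr K" for g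
    using that by (simp add: retract.hom_rng incl.hom_rng retract.hom_closed)
qed

sublocale endo: natural_transformation_from_id K "\<lambda>p. incl (retract p)" transform
proof
  have "continuous_map (unit_space K) (discrete_topology (carrier \<Gamma>)) snd"
    unfolding unit_space_skew by (rule continuous_map_snd)
  then show "continuous_map (unit_space K) (gtop K) transform"
    unfolding gtop_skew transform_def[abs_def] by (rule continuous_map_pairedI[OF section_continuous])
  show "gsrc K (transform u) = u" if "u \<in> gunits K" for u
    using section_src[OF that] by (simp add: transform_def gsrc_skew)
  show "grng K (transform u) = incl (retract u)" if "u \<in> gunits K" for u
    using section_grade[OF that] retract_unit[OF that] that
    by (auto simp: transform_def grng_skew incl_def gunits_skew)
  show "gmult K (incl (retract g)) (transform (gsrc K g)) = gmult K (transform (grng K g)) g" if "g \<in> garr K" for g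
    using retract_mult_section[OF that] by (simp add: gmult_skew incl_def transform_def gsrc_skew)
qed

lemma nerve_map_incl_retract: "nerve_map incl n (nerve_map retract n g) = nerve_map (\<lambda>p. incl (retract p)) n g"
  by (auto simp: nerve_map_def intro!: restrict_ext)

sublocale retract: etale_hom K L retract
proof
  have "etale_map (nerve K 0) (nerve K 0) (\<lambda>g. nerve_map incl 0 (nerve_map retract 0 g))"
    unfolding nerve_map_incl_retract by (rule endo.etale_units)
  then show "etale_map (nerve K 0) (nerve L 0) (nerve_map retract 0)"
    by (rule etale_map_cancel[OF _ incl.etale_units retract.continuous_map_nerve_map])
qed

lemma retract_incl:
  assumes x: "x \<in> garr L"
  shows "retract (incl x) = x"
proof -
  have xG: "x \<in> garr G" and cx: "c x = \<one>\<^bsub>\<Gamma>\<^esub>" using x by (auto simp: garr_identity)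
  have "composable G x (gsrc G x)" by (simp add: composable_def xG src_closed rng_src)
  from mult_inv_cancel[OF this] show ?thesis
    using xG cx by (simp add: retract_def incl_def grng_skew gsrc_skew section_identity
        src_in_gunits rng_in_gunits rng_mult_self mult_src)
qed

lemma retract_chain_incl_chain:
  assumes f: "f \<in> Cc (nerve L n)"
  shows "retract.chain_map n (incl.chain_map n f) = f"
proof -
  have "nerve_map retract n (nerve_map incl n g) = g" if g: "g \<in> topspace (nerve L n)" for g
  proof (rule extensionalityI[where A = "{1..max 1 n}"])
    show "nerve_map retract n (nerve_map incl n g) j = g j" if "j \<in> {1..max 1 n}" for j
      using that L.nerve_garr[OF g, of j] by (simp add: nerve_map_def retract_incl)
  qed (use g in \<open>auto simp: nerve_map_def L.nerve_iff\<close>)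
  then have "pushforward (nerve L n) (\<lambda>g. nerve_map retract n (nerve_map incl n g)) f = pushforward (nerve L n) (\<lambda>g. g) f"
    by (rule pushforward_cong)
  then show ?thesis
    unfolding retract.chain_map_def incl.chain_map_def
    by (simp add: pushforward_compose[OF incl.etale_map_nerve_map retract.etale_map_nerve_map f] pushforward_id[OF f])
qed

lemma incl_chain_retract_chain:
  assumes f: "f \<in> Cc (nerve K n)"
  shows "incl.chain_map n (retract.chain_map n f) = endo.chain_map n f"
  unfolding retract.chain_map_def incl.chain_map_def endo.chain_map_def
  by (simp add: pushforward_compose[OF retract.etale_map_nerve_map incl.etale_map_nerve_map f] nerve_map_incl_retract)

text \<open>If \<open>retract\<close> sends a cycle to a boundary, then so does \<open>incl \<circ> retract\<close>, and a cycle is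
  homologous to its image under \<open>incl \<circ> retract\<close>.\<close>

lemma retract_chain_boundary_iff:
  assumes z: "z \<in> cycles K n"
  shows "retract.chain_map n z \<in> boundaries L n \<longleftrightarrow> z \<in> boundaries K n"
proof
  have zC: "z \<in> Cc (nerve K n)" using z by (simp add: cycles_def)
  assume "retract.chain_map n z \<in> boundaries L n"
  then have "endo.chain_map n z \<in> boundaries K n"
    using incl.chain_boundaries incl_chain_retract_chain[OF zC] by metis
  from subgroup.m_closed[OF K.subgroup_boundaries endo.cycle_homologous_chain[OF z] this]
  have "(\<lambda>y. (z y - endo.chain_map n z y) + endo.chain_map n z y) \<in> boundaries K n"
    by (simp add: Cc_group_def)
  then show "z \<in> boundaries K n" by simp
qed (rule retract.chain_boundaries)

text \<open>The chain map of \<open>retract\<close> is onto on cycles because \<open>retract \<circ> incl\<close> is the identity, and its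
  kernel modulo boundaries is trivial by the chain homotopy.\<close>

theorem homology_skew_iso: "groupoid_homology K n \<cong> groupoid_homology L n"
  unfolding groupoid_homology_def
proof (rule subquotient_iso[where \<phi> = "retract.chain_map n"])
  show "retract.chain_map n \<in> hom (Cc_group (nerve K n)) (Cc_group (nerve L n))"
    using retract.chain_in_Cc[of _ n] retract.chain_add[of _ n] by (auto simp: hom_def Cc_group_def)
  show "retract.chain_map n ` cycles K n = cycles L n"
  proof (intro equalityI subsetI)
    fix z assume z: "z \<in> cycles L n"
    then have "z = retract.chain_map n (incl.chain_map n z)"
      using retract_chain_incl_chain by (simp add: cycles_def)
    then show "z \<in> retract.chain_map n ` cycles K n"
      using incl.chain_cycles[OF z] by (rule image_eqI)
  qed (auto intro: retract.chain_cycles)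
qed (fact Cc_comm_group K.subgroup_cycles L.subgroup_cycles L.subgroup_boundaries
      L.boundaries_subset_cycles K.boundaries_subset_cycles retract_chain_boundary_iff)+

end

section \<open>Continuous homogeneous sections\<close>

lemma sigma_compact_imp_Lindelof_space:
  assumes "sigma_compact_space X"
  shows "Lindelof_space X"
proof -
  obtain \<K> where \<K>: "countable \<K>" "\<And>K. K \<in> \<K> \<Longrightarrow> compactin X K" "\<Union>\<K> = topspace X"
    using assms by (auto simp: sigma_compact_space_def)
  have "Lindelof_space (subtopology X (\<Union>\<K>))"
    using \<K>(1,2) by (intro Lindelof_space_Union compact_imp_Lindelof_space) (auto simp: compactin_subspace)
  then show ?thesis by (simp add: \<K>(3))
qed

text \<open>Countably many of the sets \<open>f ` U\<close> cover \<open>Y\<close>. They are open, and closed as compact subsets of a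
  Hausdorff space, so removing from each one its predecessors leaves a partition of \<open>Y\<close> into open
  sets, on each of which one of the local inverses of \<open>f\<close> is used.\<close>

lemma etale_map_global_section:
  assumes f: "etale_map X Y f" and Y: "Hausdorff_space Y" "Lindelof_space Y"
    and S: "\<And>y. y \<in> topspace Y \<Longrightarrow> \<exists>U. openin X U \<and> compactin X U \<and> inj_on f U \<and> U \<subseteq> S \<and> y \<in> f ` U"
  shows "\<exists>s. continuous_map Y X s \<and> (\<forall>y\<in>topspace Y. f (s y) = y \<and> s y \<in> S)"
proof -
  define \<U> where "\<U> = {U. openin X U \<and> compactin X U \<and> inj_on f U \<and> U \<subseteq> S}"
  have op: "openin Y (f ` U)" if "openin X U" for U
    using etale_mapD(2)[OF f] that by (auto simp: open_map_def)
  have opU: "openin Y V" if "V \<in> (`) f ` \<U>" for V using that op by (auto simp: \<U>_def)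
  have "topspace Y \<subseteq> \<Union>((`) f ` \<U>)"
  proof
    fix y assume "y \<in> topspace Y"
    then obtain U where "U \<in> \<U>" "y \<in> f ` U" using S[of y] unfolding \<U>_def by blast
    then show "y \<in> \<Union>((`) f ` \<U>)" by blast
  qed
  moreover have "\<Union>((`) f ` \<U>) \<subseteq> topspace Y" using opU openin_subset by blast
  ultimately have cov: "\<Union>((`) f ` \<U>) = topspace Y" by (rule subset_antisym[rotated])
  then obtain \<W> where \<W>: "countable \<W>" "\<W> \<subseteq> (`) f ` \<U>" "\<Union>\<W> = topspace Y"
    using Lindelof_spaceD[OF Y(2) opU cov] by auto
  obtain \<V> where \<V>: "\<V> \<subseteq> \<U>" "countable \<V>" "\<W> = (`) f ` \<V>"
    using iffD1[OF countable_subset_image conjI[OF \<W>(1,2)]] by auto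
  \<comment> \<open>The empty set is added so that the enumeration also makes sense when \<open>Y\<close> is empty.\<close>
  define U where "U = from_nat_into (insert {} \<V>)"
  have "{} \<in> \<U>" by (simp add: \<U>_def)
  then have U\<U>: "U i \<in> \<U>" for i
    using from_nat_into[of "insert {} \<V>" i] \<V>(1) unfolding U_def by auto
  have U: "openin X (U i)" "compactin X (U i)" "inj_on f (U i)" "U i \<subseteq> S" for i
    using U\<U>[of i] by (auto simp: \<U>_def)
  have rU: "range U = insert {} \<V>"
    unfolding U_def using \<V>(2) by (intro range_from_nat_into) auto
  have cover: "\<exists>i. y \<in> f ` U i" if y: "y \<in> topspace Y" for y
  proof -
    have "y \<in> \<Union>((`) f ` \<V>)" using y \<W>(3) by (simp only: \<V>(3))
    then obtain V where V: "V \<in> \<V>" "y \<in> f ` V" by (elim UnionE imageE) simp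
    then have "V \<in> range U" using rU by simp
    then show ?thesis using V(2) by auto
  qed
  define D where "D i = f ` U i - (\<Union>j<i. f ` U j)" for i
  have D_open: "openin Y (D i)" for i
  proof -
    have "closedin Y (f ` U j)" for j
      using compactin_imp_closedin[OF Y(1)] image_compactin[OF U(2) etale_mapD(1)[OF f]] by blast
    then have "closedin Y (\<Union>j<i. f ` U j)" by (intro closedin_Union) auto
    then show ?thesis unfolding D_def using op[OF U(1)] by blast
  qed
  define N where "N y = (LEAST i. y \<in> f ` U i)" for y
  have N: "y \<in> D (N y)" if y: "y \<in> topspace Y" for y
  proof -
    have "y \<in> f ` U (N y)" unfolding N_def using cover[OF y] by (rule LeastI_ex)
    moreover have "y \<notin> f ` U j" if "j < N y" for j using not_less_Least that unfolding N_def by blast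
    ultimately show ?thesis unfolding D_def by blast
  qed
  have N_eq: "N y = i" if y: "y \<in> D i" for y i
    unfolding N_def
  proof (rule Least_equality)
    show "y \<in> f ` U i" using y by (simp add: D_def)
    show "i \<le> j" if "y \<in> f ` U j" for j using y that unfolding D_def by (meson DiffD2 UN_I lessThan_iff not_le)
  qed
  define s where "s y = inv_into (U (N y)) f y" for y
  have s: "s y \<in> U (N y)" "f (s y) = y" if "y \<in> topspace Y" for y
    using N[OF that] by (auto simp: s_def D_def inv_into_into f_inv_into_f)
  have "continuous_map Y X s"
    unfolding continuous_map_def
  proof (intro conjI allI impI)
    show "s \<in> topspace Y \<rightarrow> topspace X" using s(1) U(1) openin_subset by blast
    fix W assume W: "openin X W"
    have "{y \<in> topspace Y. s y \<in> W} = (\<Union>i. D i \<inter> f ` (U i \<inter> W))"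
    proof (intro equalityI subsetI)
      fix y assume y: "y \<in> {y \<in> topspace Y. s y \<in> W}"
      then have "y \<in> f ` (U (N y) \<inter> W)" using s[of y] by (intro image_eqI[of y f "s y"]) auto
      then show "y \<in> (\<Union>i. D i \<inter> f ` (U i \<inter> W))" using N[of y] y by blast
    next
      fix y assume "y \<in> (\<Union>i. D i \<inter> f ` (U i \<inter> W))"
      then obtain i x where x: "y \<in> D i" "x \<in> U i" "x \<in> W" "y = f x" by blast
      then have "s y = x" using U(3)[of i] N_eq[OF x(1)] by (simp add: s_def)
      then show "y \<in> {y \<in> topspace Y. s y \<in> W}" using x openin_subset[OF D_open] by blast
    qed
    moreover have "openin Y (D i \<inter> f ` (U i \<inter> W))" for i
      by (intro openin_Int D_open op U(1) W)
    ultimately show "openin Y {y \<in> topspace Y. s y \<in> W}" by auto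
  qed
  moreover have "s y \<in> S" if "y \<in> topspace Y" for y using s(1)[OF that] U(4) by blast
  ultimately show ?thesis using s(2) by blast
qed

lemma ample_groupoid_imp_Hausdorff_etale:
  assumes "ample_groupoid G"
  shows "Hausdorff_etale_groupoid G"
proof -
  interpret ample_groupoid G by (rule assms)
  show ?thesis
  proof unfold_locales
    have "gsrc G ` topspace (gtop G) \<subseteq> topspace (unit_space G)"
      using src_in_gunits by (auto simp: topspace_unit_space garr_def)
    then show "etale_map (gtop G) (unit_space G) (gsrc G)"
      by (rule local_homeomorphism_imp_etale_map[OF local_homeomorphism_src])
  qed (rule Hausdorff)
qed

text \<open>Through every unit \<open>u\<close> there is such a local section: \<open>u\<close> has degree \<open>\<gamma>\<inverse>\<gamma>\<close>, so strong grading
  factors it as \<open>u = gh\<close> with \<open>h\<close> of degree \<open>\<gamma>\<close>, and then \<open>s(h) = u\<close>. A compact open bisection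
  around \<open>h\<close> inside the open set of elements of degree \<open>\<gamma>\<close> does the rest.\<close>

lemma strongly_graded_continuous_section:
  fixes G :: "'a top_groupoid"
  assumes ample: "ample_groupoid G" and graded: "strongly_graded_groupoid G \<Gamma> c"
    and sigma: "sigma_compact_space (unit_space G)" and \<gamma>: "\<gamma> \<in> carrier \<Gamma>"
  shows "\<exists>s. continuous_map (unit_space G) (gtop G) s \<and> (\<forall>u\<in>gunits G. gsrc G (s u) = u \<and> c (s u) = \<gamma>)"
proof -
  interpret ample_groupoid G by (rule ample)
  interpret strongly_graded_groupoid G \<Gamma> c by (rule graded)
  interpret H: Hausdorff_etale_groupoid G by (rule ample_groupoid_imp_Hausdorff_etale[OF ample])
  interpret graded_etale_groupoid G \<Gamma> c ..
  let ?S = "homogeneous_part G c \<gamma>"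
  have "openin (gtop G) {g \<in> topspace (gtop G). c g \<in> {\<gamma>}}"
    using \<gamma> by (intro openin_continuous_map_preimage[OF continuous_grading]) simp
  then have S_open: "openin (gtop G) ?S" by (simp add: homogeneous_part_def garr_def)
  have HY: "Hausdorff_space (unit_space G)"
    unfolding unit_space_def using Hausdorff by (rule Hausdorff_space_subtopology)
  have "\<exists>U. openin (gtop G) U \<and> compactin (gtop G) U \<and> inj_on (gsrc G) U \<and> U \<subseteq> ?S \<and> u \<in> gsrc G ` U"
    if "u \<in> topspace (unit_space G)" for u
  proof -
    have u: "u \<in> gunits G" using that by (simp add: topspace_unit_space)
    then have "u \<in> homogeneous_part G c (inv\<^bsub>\<Gamma>\<^esub> \<gamma> \<otimes>\<^bsub>\<Gamma>\<^esub> \<gamma>)"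
      using grade_unit[OF u] \<gamma> by (simp add: homogeneous_part_def gunits_iff)
    then have "u \<in> set_product G (homogeneous_part G c (inv\<^bsub>\<Gamma>\<^esub> \<gamma>)) ?S"
      using strongly_graded[of "inv\<^bsub>\<Gamma>\<^esub> \<gamma>" \<gamma>] \<gamma> by simp
    then obtain g h where h: "u = gmult G g h" "h \<in> ?S" "composable G g h" by (auto simp: set_product_def)
    have hu: "gsrc G h = u" using src_mult[OF h(3)] src_unit[OF u] h(1) by simp
    obtain U where U: "open_bisection G U" "compactin (gtop G) U" "h \<in> U" "U \<subseteq> ?S"
      using compact_open_bisection_basis[OF S_open h(2)] by blast
    have Uo: "openin (gtop G) U" and hm: "homeomorphic_map (subtopology (gtop G) U) (subtopology (unit_space G) (gsrc G ` U)) (gsrc G)"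
      using U(1) by (auto simp: open_bisection_def)
    have "inj_on (gsrc G) U"
      using homeomorphic_imp_injective_map[OF hm] openin_subset[OF Uo] by (simp add: Int_absorb1)
    then show ?thesis using U Uo hu by blast
  qed
  from etale_map_global_section[OF H.etale_src HY sigma_compact_imp_Lindelof_space[OF sigma] this]
  obtain s where "continuous_map (unit_space G) (gtop G) s"
    "\<forall>u\<in>topspace (unit_space G). gsrc G (s u) = u \<and> s u \<in> ?S" by blast
  then show ?thesis by (auto simp: topspace_unit_space homogeneous_part_def)
qed

lemma continuous_map_prod_discrete:
  assumes "\<And>a. a \<in> A \<Longrightarrow> continuous_map X Y (\<lambda>x. f (x, a))"
  shows "continuous_map (prod_topology X (discrete_topology A)) Y f"
  unfolding continuous_map_def
proof (intro conjI allI impI)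
  show "f \<in> topspace (prod_topology X (discrete_topology A)) \<rightarrow> topspace Y"
    using assms by (auto simp: continuous_map_def)
  fix W assume W: "openin Y W"
  have "{p \<in> topspace (prod_topology X (discrete_topology A)). f p \<in> W} =
      (\<Union>a\<in>A. {x \<in> topspace X. f (x, a) \<in> W} \<times> {a})" by auto
  moreover have "openin (prod_topology X (discrete_topology A)) ({x \<in> topspace X. f (x, a) \<in> W} \<times> {a})"
    if "a \<in> A" for a
    using openin_continuous_map_preimage[OF assms[OF that] W] that by (simp add: openin_prod_Times_iff)
  ultimately show "openin (prod_topology X (discrete_topology A)) {p \<in> topspace (prod_topology X (discrete_topology A)). f p \<in> W}"
    by auto
qed

section \<open>Graded homology of strongly graded groupoids\<close>

theorem theorem5p4:
  fixes \<Gamma> :: "('g, 'k) monoid_scheme"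
    and G :: "'a top_groupoid"
    and c :: "'a \<Rightarrow> 'g"
  assumes "ample_groupoid G"
    and "strongly_graded_groupoid G \<Gamma> c"
    and "sigma_compact_space (unit_space G)"
  shows "\<forall>n::nat. graded_homology \<Gamma> G c n \<cong> groupoid_homology (identity_subgroupoid \<Gamma> G c) n"
proof -
  interpret strongly_graded_groupoid G \<Gamma> c by (rule assms(2))
  interpret H: Hausdorff_etale_groupoid G by (rule ample_groupoid_imp_Hausdorff_etale[OF assms(1)])
  interpret graded_etale_groupoid G \<Gamma> c ..
  have "\<exists>s. continuous_map (unit_space G) (gtop G) s \<and>
      (\<forall>u\<in>gunits G. gsrc G (s u) = u \<and> c (s u) = inv\<^bsub>\<Gamma>\<^esub> \<alpha>)" if "\<alpha> \<in> carrier \<Gamma>" for \<alpha>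
    using strongly_graded_continuous_section[OF assms] that by simp
  then obtain s where s: "\<And>\<alpha>. \<alpha> \<in> carrier \<Gamma> \<Longrightarrow> continuous_map (unit_space G) (gtop G) (s \<alpha>)"
    "\<And>\<alpha> u. \<alpha> \<in> carrier \<Gamma> \<Longrightarrow> u \<in> gunits G \<Longrightarrow> gsrc G (s \<alpha> u) = u"
    "\<And>\<alpha> u. \<alpha> \<in> carrier \<Gamma> \<Longrightarrow> u \<in> gunits G \<Longrightarrow> c (s \<alpha> u) = inv\<^bsub>\<Gamma>\<^esub> \<alpha>"
    by metis
  \<comment> \<open>The lemma provides some section on colour \<open>\<epsilon>\<close>, but the normalisation asks for the identity there.\<close>
  define b where "b p = (if snd p = \<one>\<^bsub>\<Gamma>\<^esub> then fst p else s (snd p) (fst p))" for p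
  interpret graded_groupoid_with_sections G \<Gamma> c b
  proof
    have id: "continuous_map (unit_space G) (gtop G) (\<lambda>u. u)"
      unfolding unit_space_def by (intro continuous_map_from_subtopology continuous_map_id[unfolded id_def])
    show "continuous_map (unit_space K) (gtop G) b"
      unfolding unit_space_skew
    proof (rule continuous_map_prod_discrete)
      show "continuous_map (unit_space G) (gtop G) (\<lambda>u. b (u, \<alpha>))" if "\<alpha> \<in> carrier \<Gamma>" for \<alpha>
        using id s(1)[OF that] by (cases "\<alpha> = \<one>\<^bsub>\<Gamma>\<^esub>") (simp_all add: b_def)
    qed
    show "gsrc G (b p) = fst p" if "p \<in> gunits K" for p
      using that s(2) src_unit by (auto simp: b_def gunits_skew)
    show "c (b p) = inv\<^bsub>\<Gamma>\<^esub> (snd p)" if "p \<in> gunits K" for p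
      using that s(3) grade_unit by (auto simp: b_def gunits_skew)
    show "b (u, \<one>\<^bsub>\<Gamma>\<^esub>) = u" for u by (simp add: b_def)
  qed
  show ?thesis using homology_skew_iso by (simp add: graded_homology_def)
qed

end
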